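(* Let $n\ge 2$. Each $n$-strand braid $\beta\in B_n$ admits a $\sigma$-definite expression of length at most $6(n-1)^2\,\|\beta\|_\sigma$; that is, there is a $\sigma$-definite word in the letters $\sigma_1^{\pm1},\dots,\sigma_{n-1}^{\pm1}$ that represents $\beta$ and has length at most $6(n-1)^2\,\|\beta\|_\sigma$.
   Context: $B_n$ is Artin's braid group, generated by $\sigma_1,\dots,\sigma_{n-1}$ with relations $\sigma_i\sigma_j=\sigma_j\sigma_i$ for $|i-j|\ge2$ and $\sigma_i\sigma_j\sigma_i=\sigma_j\sigma_i\sigma_j$ for $|i-j|=1$. For $\beta\in B_n$, $\|\beta\|_\sigma$ denotes the length of the shortest word in the letters $\sigma_i^{\pm1}$ representing $\beta$. A braid word is $\sigma$-definite if the generator $\sigma_i$ of highest index $i$ occurring in it (as $\sigma_i$ or $\sigma_i^{-1}$) occurs only positively (no $\sigma_i^{-1}$; the word is then called $\sigma$-positive) or only negatively (no $\sigma_i$; the word is then called $\sigma$-negative). The empty word is considered $\sigma$-definite. *)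

theory Defs
  imports "HOL-Algebra.Group"
begin

datatype braid_letter = Sig (index: nat) | SigInv (index: nat)

fun inv_letter :: "braid_letter \<Rightarrow> braid_letter" where
  "inv_letter (Sig i) = SigInv i"
| "inv_letter (SigInv i) = Sig i"

type_synonym braid_word = "braid_letter list"

definition braid_words :: "nat \<Rightarrow> braid_word set" where
  "braid_words n = {w. \<forall>l\<in>set w. 1 \<le> index l \<and> index l < n}"

text \<open>The group \<open>B\<^sub>n\<close> is built as the set of words in the letters and their formal inverses,
  modulo the congruence generated by free cancellation and the Artin relations.\<close>

inductive braid_rule :: "nat \<Rightarrow> braid_word \<Rightarrow> braid_word \<Rightarrow> bool" for n :: nat where
  cancel: "[x, inv_letter x] \<in> braid_words n \<Longrightarrow> braid_rule n [x, inv_letter x] []"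
| far: "[Sig i, Sig j] \<in> braid_words n \<Longrightarrow> \<bar>int i - int j\<bar> \<ge> 2 \<Longrightarrow>
    braid_rule n [Sig i, Sig j] [Sig j, Sig i]"
| near: "[Sig i, Sig j] \<in> braid_words n \<Longrightarrow> \<bar>int i - int j\<bar> = 1 \<Longrightarrow>
    braid_rule n [Sig i, Sig j, Sig i] [Sig j, Sig i, Sig j]"

inductive braid_equiv :: "nat \<Rightarrow> braid_word \<Rightarrow> braid_word \<Rightarrow> bool" for n :: nat where
  refl: "u \<in> braid_words n \<Longrightarrow> braid_equiv n u u"
| sym: "braid_equiv n u v \<Longrightarrow> braid_equiv n v u"
| trans: "braid_equiv n u v \<Longrightarrow> braid_equiv n v w \<Longrightarrow> braid_equiv n u w"
| rule: "u \<in> braid_words n \<Longrightarrow> v \<in> braid_words n \<Longrightarrow> braid_rule n l r \<Longrightarrow>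
    braid_equiv n (u @ l @ v) (u @ r @ v)"

definition braid_of :: "nat \<Rightarrow> braid_word \<Rightarrow> braid_word set" where
  "braid_of n w = {v. braid_equiv n w v}"

definition braid_group :: "nat \<Rightarrow> braid_word set monoid" where
  "braid_group n = \<lparr>
     carrier = braid_of n ` braid_words n,
     mult = (\<lambda>A B. \<Union>u\<in>A. \<Union>v\<in>B. braid_of n (u @ v)),
     one = braid_of n [] \<rparr>"

definition sigma_length :: "nat \<Rightarrow> braid_word set \<Rightarrow> nat" where
  "sigma_length n \<beta> = (LEAST k. \<exists>w\<in>braid_words n. braid_of n w = \<beta> \<and> length w = k)"

definition max_index :: "braid_word \<Rightarrow> nat" where
  "max_index w = Max (index ` set w)"

definition sigma_positive :: "braid_word \<Rightarrow> bool" where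
  "sigma_positive w \<longleftrightarrow> w \<noteq> [] \<and> SigInv (max_index w) \<notin> set w"

definition sigma_negative :: "braid_word \<Rightarrow> bool" where
  "sigma_negative w \<longleftrightarrow> w \<noteq> [] \<and> Sig (max_index w) \<notin> set w"

definition sigma_definite :: "braid_word \<Rightarrow> bool" where
  "sigma_definite w \<longleftrightarrow> w = [] \<or> sigma_positive w \<or> sigma_negative w"

lemma braid_words_Nil [simp]: "[] \<in> braid_words n"
  by (simp add: braid_words_def)

lemma braid_words_append [simp]:
  "u @ v \<in> braid_words n \<longleftrightarrow> u \<in> braid_words n \<and> v \<in> braid_words n"
  by (auto simp: braid_words_def)

lemma braid_words_Cons:
  "x # v \<in> braid_words n \<longleftrightarrow> [x] \<in> braid_words n \<and> v \<in> braid_words n"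
  by (auto simp: braid_words_def)

lemma index_inv_letter [simp]: "index (inv_letter x) = index x"
  by (cases x) auto

lemma inv_letter_inv_letter [simp]: "inv_letter (inv_letter x) = x"
  by (cases x) auto

lemma braid_rule_words: "braid_rule n l r \<Longrightarrow> l \<in> braid_words n \<and> r \<in> braid_words n"
  by (induction rule: braid_rule.induct) (auto simp: braid_words_def)

lemma braid_equiv_words: "braid_equiv n u v \<Longrightarrow> u \<in> braid_words n \<and> v \<in> braid_words n"
  by (induction rule: braid_equiv.induct) (auto dest: braid_rule_words)

lemma braid_equiv_append_cong:
  assumes "braid_equiv n u u'" "braid_equiv n v v'"
  shows "braid_equiv n (u @ v) (u' @ v')"
proof -
  have R: "braid_equiv n (a @ w) (b @ w)" if "braid_equiv n a b" "w \<in> braid_words n" for a b w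
    using that
  proof (induction rule: braid_equiv.induct)
    case (rule u v l r)
    then show ?case
      using braid_equiv.rule[of u n "v @ w" l r] by simp
  next
    case (refl u)
    then show ?case by (simp add: braid_equiv.refl)
  next
    case (sym u v)
    then show ?case by (simp add: braid_equiv.sym)
  next
    case (trans u v v')
    then show ?case by (meson braid_equiv.trans)
  qed
  have L: "braid_equiv n (w @ a) (w @ b)" if "braid_equiv n a b" "w \<in> braid_words n" for a b w
    using that
  proof (induction rule: braid_equiv.induct)
    case (rule u v l r)
    then show ?case
      using braid_equiv.rule[of "w @ u" n v l r] by simp
  next
    case (refl u)
    then show ?case by (simp add: braid_equiv.refl)
  next
    case (sym u v)
    then show ?case by (simp add: braid_equiv.sym)
  next
    case (trans u v v')
    then show ?case by (meson braid_equiv.trans)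
  qed
  have "v \<in> braid_words n" "u' \<in> braid_words n"
    using assms by (auto dest: braid_equiv_words)
  then show ?thesis
    using braid_equiv.trans[OF R[OF assms(1)] L[OF assms(2)]] by simp
qed

lemma braid_of_eq_iff:
  assumes u: "u \<in> braid_words n"
  shows "braid_of n u = braid_of n v \<longleftrightarrow> braid_equiv n u v"
proof
  assume eq: "braid_of n u = braid_of n v"
  have "u \<in> braid_of n u"
    using u by (simp add: braid_of_def braid_equiv.refl)
  then show "braid_equiv n u v"
    unfolding eq by (simp add: braid_of_def braid_equiv.sym)
next
  assume "braid_equiv n u v"
  then show "braid_of n u = braid_of n v"
    unfolding braid_of_def set_eq_iff mem_Collect_eq by (meson braid_equiv.sym braid_equiv.trans)
qed

lemma mult_braid_of:
  assumes "u \<in> braid_words n" "v \<in> braid_words n"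
  shows "braid_of n u \<otimes>\<^bsub>braid_group n\<^esub> braid_of n v = braid_of n (u @ v)"
proof -
  have "braid_of n (u' @ v') = braid_of n (u @ v)"
    if "u' \<in> braid_of n u" "v' \<in> braid_of n v" for u' v'
  proof -
    have "braid_equiv n (u @ v) (u' @ v')"
      using that by (simp add: braid_of_def braid_equiv_append_cong)
    then show ?thesis
      using assms braid_of_eq_iff[of "u @ v" n "u' @ v'"] by simp
  qed
  moreover have "u \<in> braid_of n u" "v \<in> braid_of n v"
    using assms by (simp_all add: braid_of_def braid_equiv.refl)
  ultimately have "(\<Union>u'\<in>braid_of n u. \<Union>v'\<in>braid_of n v. braid_of n (u' @ v')) = braid_of n (u @ v)"
    by blast
  then show ?thesis
    by (simp add: braid_group_def)
qed

lemma braid_equiv_inverse: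
  "w \<in> braid_words n \<Longrightarrow> braid_equiv n (rev (map inv_letter w) @ w) []"
proof (induction w)
  case Nil
  then show ?case by (simp add: braid_equiv.refl)
next
  case (Cons x w)
  let ?w' = "rev (map inv_letter w)"
  have w: "w \<in> braid_words n" "?w' \<in> braid_words n"
    and x: "[inv_letter x, inv_letter (inv_letter x)] \<in> braid_words n"
    using Cons.prems by (auto simp: braid_words_def)
  have "braid_equiv n (?w' @ [inv_letter x, x] @ w) (?w' @ [] @ w)"
    using braid_equiv.rule[OF w(2) w(1) braid_rule.cancel[OF x]] by simp
  then show ?case
    using braid_equiv.trans[OF _ Cons.IH[OF w(1)]] by simp
qed

lemma group_braid_group: "group (braid_group n)"
proof (rule groupI)
  fix \<beta> assume "\<beta> \<in> carrier (braid_group n)"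
  then obtain w where w: "w \<in> braid_words n" "\<beta> = braid_of n w"
    by (auto simp: braid_group_def)
  let ?w' = "rev (map inv_letter w)"
  have w': "?w' \<in> braid_words n"
    using w by (auto simp: braid_words_def)
  have "braid_of n ?w' \<otimes>\<^bsub>braid_group n\<^esub> \<beta> = \<one>\<^bsub>braid_group n\<^esub>"
    using w w' mult_braid_of[OF w' w(1)] braid_equiv_inverse[OF w(1)]
    by (simp add: braid_of_eq_iff braid_group_def)
  then show "\<exists>\<gamma>\<in>carrier (braid_group n). \<gamma> \<otimes>\<^bsub>braid_group n\<^esub> \<beta> = \<one>\<^bsub>braid_group n\<^esub>"
    using w' by (auto simp: braid_group_def)
next
  fix \<alpha> \<beta> assume "\<alpha> \<in> carrier (braid_group n)" "\<beta> \<in> carrier (braid_group n)"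
  then obtain u v where "u \<in> braid_words n" "v \<in> braid_words n"
    "\<alpha> = braid_of n u" "\<beta> = braid_of n v"
    by (auto simp: braid_group_def)
  then show "\<alpha> \<otimes>\<^bsub>braid_group n\<^esub> \<beta> \<in> carrier (braid_group n)"
    by (simp add: mult_braid_of) (simp add: braid_group_def)
next
  show "\<one>\<^bsub>braid_group n\<^esub> \<in> carrier (braid_group n)"
    by (auto simp: braid_group_def)
next
  fix \<alpha> \<beta> \<gamma>
  assume "\<alpha> \<in> carrier (braid_group n)" "\<beta> \<in> carrier (braid_group n)"
    "\<gamma> \<in> carrier (braid_group n)"
  then obtain u v w where "u \<in> braid_words n" "v \<in> braid_words n" "w \<in> braid_words n"
    "\<alpha> = braid_of n u" "\<beta> = braid_of n v" "\<gamma> = braid_of n w"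
    by (auto simp: braid_group_def)
  then show "\<alpha> \<otimes>\<^bsub>braid_group n\<^esub> \<beta> \<otimes>\<^bsub>braid_group n\<^esub> \<gamma> = \<alpha> \<otimes>\<^bsub>braid_group n\<^esub> (\<beta> \<otimes>\<^bsub>braid_group n\<^esub> \<gamma>)"
    by (simp add: mult_braid_of)
next
  fix \<beta> assume "\<beta> \<in> carrier (braid_group n)"
  then obtain w where "w \<in> braid_words n" "\<beta> = braid_of n w"
    by (auto simp: braid_group_def)
  moreover have "\<one>\<^bsub>braid_group n\<^esub> = braid_of n []"
    by (simp add: braid_group_def)
  ultimately show "\<one>\<^bsub>braid_group n\<^esub> \<otimes>\<^bsub>braid_group n\<^esub> \<beta> = \<beta>"
    by (simp add: mult_braid_of)
qed

end

theory Submission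
  imports Defs
begin

text \<open>The proof works in the dual presentation of the braid group by the bands
  \<open>a\<^sub>p\<^sub>,\<^sub>q\<close> (\<open>p < q\<close>), conjugates of the generators attached to the chords of \<open>n\<close> points on a
  circle. Let \<open>\<delta>\<close> be the product of all generators in increasing order. Conjugation by \<open>\<delta>\<close> rotates the
  chords, and every \<open>\<sigma>\<^sub>i\<close> inverse is \<open>\<delta>\<close> inverse times \<open>n - 2\<close> bands. Collecting the inverses of \<open>\<delta>\<close> at
  the left turns a word of length \<open>l\<close> into \<open>k \<le> l\<close> inverses of \<open>\<delta>\<close> followed by a product \<open>w\<close> of \<open>L\<close> bands, where
  \<open>L + k = l + (n - 2) k\<close>. A band ending at \<open>n\<close> is spelled with a single, positive letter of index
  \<open>n - 1\<close>; the other bands do not involve that index, and \<open>\<delta>\<close> inverse contains it once, negatively.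

  The inverses of \<open>\<delta>\<close> are now moved back into \<open>w\<close> one at a time. Write the current positive part as \<open>h x\<close>
  with \<open>x\<close> on \<open>n - 1\<close> points and as long as possible, keep \<open>x\<close>, rotate \<open>h\<close> through one inverse of \<open>\<delta>\<close>, and
  repeat. After \<open>k\<close> rounds the braid is \<open>h Z\<close>, where the tail \<open>Z\<close> alternates between inverses of \<open>\<delta>\<close> and
  products of bands on \<open>n - 1\<close> points. If \<open>h\<close> is empty and \<open>k > 0\<close>, this is a \<open>\<sigma>\<close>-negative word. Otherwise \<open>h\<close> ends
  with a band \<open>a\<^sub>p\<^sub>,\<^sub>n\<close>, and the point is that this one letter makes the whole product
  \<open>\<sigma>\<close>-positive: \<open>Z\<close> can be rewritten as \<open>z y\<close>, where \<open>y\<close> has no negative letter of index \<open>n - 1\<close> and \<open>z\<close>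
  involves only chords on the points \<open>1, \<dots>, p - 1, n\<close>. Pushing \<open>a\<^sub>p\<^sub>,\<^sub>n\<close> through \<open>z\<close> moves the endpoint \<open>n\<close> of
  its chords to \<open>p < n\<close>, so that no negative letter of index \<open>n - 1\<close> survives
  (\<open>above_sigma_pos\<close>). That \<open>Z\<close> has this form is shown by induction on the rounds
  (\<open>tail_invariant\<close>): reading a factor \<open>x\<close> from right to left, the set of points of \<open>z\<close> can only
  shrink, and if it does not shrink enough, some letter could be moved to the right end of the positive
  part, against the maximality of the factors (\<open>ladder\<close>). The rewriting adds at most two bands for each
  band of \<open>w\<close>.

  One family of tails escapes, namely those equal to the inverse of the last generator times inverses of
  \<open>\<delta>\<close> for \<open>n - 1\<close> strands times a positive word. Then the last band of \<open>h\<close> is the last generator and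
  cancels, and what is left either is \<open>\<sigma>\<close>-positive or is a fraction of the same shape on \<open>n - 1\<close>
  strands, with the same \<open>k\<close> and no more bands. Induction on \<open>n\<close> gives a \<open>\<sigma>\<close>-definite word of length at
  most \<open>(2 n - 3) (3 L + k) + k (n - 2)\<close> (\<open>over_delta_sigma_definite\<close>), and this is at most
  \<open>6 (n - 1)\<^sup>2 l\<close>.\<close>

section \<open>Artin relations and band generators\<close>

text \<open>All numbers of strands \<open>n \<le> N\<close> are treated inside one group, so that passing from \<open>n\<close> to
  \<open>n - 1\<close> strands does not change the meaning of an equation. The product of the group is written \<open>+\<close>,
  which makes the rewrite rules for noncommutative additive groups available.\<close>

locale artin_generators =
  fixes s :: "nat \<Rightarrow> 'a::group_add" and N :: nat
  assumes far: "1 \<le> i \<Longrightarrow> i + 2 \<le> j \<Longrightarrow> j < N \<Longrightarrow> s i + s j = s j + s i"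
    and near: "1 \<le> i \<Longrightarrow> i + 1 < N \<Longrightarrow> s i + s (i + 1) + s i = s (i + 1) + s i + s (i + 1)"
begin

definition delta :: "nat \<Rightarrow> nat \<Rightarrow> 'a" where
  "delta p q = sum_list (map s [p..<q])"

text \<open>The band generators of Birman, Ko and Lee: as \<open>delta p q = delta p (q - 1) + s (q - 1)\<close>, this is
  the conjugate of \<open>s (q - 1)\<close> by \<open>delta p (q - 1)\<close>; in particular \<open>band p (p + 1) = s p\<close>.\<close>

definition band :: "nat \<Rightarrow> nat \<Rightarrow> 'a" where
  "band p q = delta p q - delta p (q - 1)"

lemma delta_empty [simp]: "q \<le> p \<Longrightarrow> delta p q = 0"
  by (simp add: delta_def)

lemma delta_Suc: "p \<le> q \<Longrightarrow> delta p (Suc q) = delta p q + s q"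
  by (simp add: delta_def)

lemma delta_split: "p \<le> q \<Longrightarrow> q \<le> r \<Longrightarrow> delta p r = delta p q + delta q r"
  by (metis delta_def le_add_diff_inverse map_append sum_list_append upt_add_eq_append)

lemma delta_first: "p < q \<Longrightarrow> delta p q = s p + delta (Suc p) q"
  by (simp add: delta_def upt_conv_Cons)

lemma band_add_delta: "p < q \<Longrightarrow> band p q + delta p (q - 1) = delta p q"
  by (simp add: band_def)

text \<open>Conjugations are always stated in the form \<open>g + x = y + g\<close>, read as pushing \<open>g\<close> to the right through
  \<open>x\<close>. This lemma and the next extend such a statement to inverses and products.\<close>

lemma push_minus:
  fixes g x y :: 'a
  assumes "g + x = y + g"
  shows "g + - x = - y + g"
proof -
  have "g + - x = - y + (y + g) + - x"
    by simp
  also have "\<dots> = - y + g"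
    unfolding assms[symmetric] by (simp add: add.assoc del: add_uminus_conv_diff)
  finally show ?thesis .
qed

lemma push_add:
  fixes g x y x' y' :: 'a
  assumes "g + x = x' + g" "g + y = y' + g"
  shows "g + (x + y) = (x' + y') + g"
  using assms by (metis add.assoc)

lemma commutes_delta:
  assumes "\<And>i. p \<le> i \<Longrightarrow> i < q \<Longrightarrow> x + s i = s i + x"
  shows "x + delta p q = delta p q + x"
  using assms
proof (induction q)
  case (Suc q)
  then show ?case
    by (cases "p \<le> q") (auto simp: delta_Suc intro!: push_add)
qed simp

lemma commutes_band:
  assumes "\<And>i. p \<le> i \<Longrightarrow> i < q \<Longrightarrow> x + s i = s i + x"
  shows "x + band p q = band p q + x"
proof -
  have "x + delta p q = delta p q + x" "x + delta p (q - 1) = delta p (q - 1) + x"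
    by (auto intro!: commutes_delta assms)
  then show ?thesis
    unfolding band_def diff_conv_add_uminus by (intro push_add push_minus)
qed

lemma s_commutes_delta_far:
  assumes "1 \<le> i" "i < N" "1 \<le> p" "q \<le> N" "i + 2 \<le> p \<or> q \<le> i - 1"
  shows "s i + delta p q = delta p q + s i"
proof (rule commutes_delta)
  fix j assume "p \<le> j" "j < q"
  then show "s i + s j = s j + s i"
    using assms far[of i j] far[of j i] by auto
qed

text \<open>The braid relation enters the theory here: in \<open>delta p q\<close> the factors before \<open>s i + s (i + 1)\<close> commute
  with \<open>s (i + 1)\<close>, and those after it commute with \<open>s i\<close>.\<close>

lemma delta_shift:
  assumes "1 \<le> p" "p \<le> i" "i + 1 < q" "q \<le> N"
  shows "delta p q + s i = s (i + 1) + delta p q"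
proof -
  have c1: "s i + delta (i + 2) q = delta (i + 2) q + s i"
    and c2: "s (i + 1) + delta p i = delta p i + s (i + 1)"
    using assms by (auto intro!: s_commutes_delta_far)
  have d: "delta p q = delta p i + (s i + s (i + 1) + delta (i + 2) q)"
    using assms delta_split[of p i q] delta_first[of i q] delta_first[of "Suc i" q]
    by (simp add: add.assoc)
  have "delta p q + s i = delta p i + (s i + s (i + 1) + s i) + delta (i + 2) q"
    using c1 by (simp add: d add.assoc)
  also have "\<dots> = s (i + 1) + delta p q"
    using near[of i] assms c2 by (simp add: d add.assoc[symmetric])
  finally show ?thesis .
qed

lemma delta_shift_delta:
  assumes "1 \<le> p" "p \<le> r" "t < q" "q \<le> N"
  shows "delta p q + delta r t = delta (r + 1) (t + 1) + delta p q"
  using assms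
proof (induction t)
  case (Suc t)
  show ?case
  proof (cases "r \<le> t")
    case True
    then have "delta p q + delta r (Suc t) = delta (r + 1) (t + 1) + (delta p q + s t)"
      using Suc by (simp add: delta_Suc add.assoc[symmetric])
    then show ?thesis
      using True Suc.prems delta_shift[of p t q] by (simp add: delta_Suc add.assoc[symmetric])
  qed simp
qed simp

text \<open>The mirror image of the defining formula. The relations between bands come from choosing, for each
  band, the formula whose factors commute with the other band.\<close>

lemma band_alt:
  assumes "1 \<le> p" "p < q" "q \<le> N"
  shows "band p q = - delta (p + 1) q + delta p q"
proof -
  have "delta p q + delta p (q - 1) = delta (p + 1) q + delta p q"
    using delta_shift_delta[of p p "q - 1" q] assms by simp
  then have "- delta (p + 1) q + delta p q + delta p (q - 1) = delta p q"
    by (simp add: add.assoc)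
  then show ?thesis
    by (simp add: band_def diff_eq_eq)
qed

lemma band_commutes_below:
  assumes "1 \<le> p" "p < q" "q < r" "r < t" "t \<le> N"
  shows "band p q + band r t = band r t + band p q"
proof (rule commutes_band)
  fix i assume i: "r \<le> i" "i < t"
  have "s i + band p q = band p q + s i"
  proof (rule commutes_band)
    fix j assume "p \<le> j" "j < q"
    then show "s i + s j = s j + s i" using assms i far[of j i] by auto
  qed
  then show "band p q + s i = s i + band p q" by simp
qed

lemma band_commutes_inside:
  assumes "1 \<le> p" "p < r" "r < t" "t < q" "q \<le> N"
  shows "band p q + band r t = band r t + band p q"
proof (rule commutes_band)
  fix i assume i: "r \<le> i" "i < t"
  then obtain j where j: "i = Suc j" "p \<le> j"
    using assms by (cases i) auto
  have A: "delta p q + s j = s i + delta p q"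
    and B: "delta p (q - 1) + s j = s i + delta p (q - 1)"
    using delta_shift[of p j q] delta_shift[of p j "q - 1"] assms i j by auto
  have "- delta p (q - 1) + (s i + delta p (q - 1)) = s j"
    unfolding B[symmetric] by simp
  then have "band p q + s i + delta p (q - 1) = delta p q + s j"
    unfolding band_def by (simp add: add.assoc diff_conv_add_uminus del: add_uminus_conv_diff)
  also have "\<dots> = s i + band p q + delta p (q - 1)"
    using A by (simp add: band_def add.assoc diff_conv_add_uminus del: add_uminus_conv_diff)
  finally show "band p q + s i = s i + band p q"
    by simp
qed

lemma delta_commutes_band:
  assumes "1 \<le> p" "p < q" "q \<le> N" "1 \<le> r" "t \<le> N" "t < p \<or> q < r"
  shows "delta r t + band p q = band p q + delta r t"
proof (rule commutes_band)
  fix i assume i: "p \<le> i" "i < q"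
  then have "t < p \<Longrightarrow> t \<le> i - 1" "q < r \<Longrightarrow> i + 2 \<le> r"
    by auto
  then show "delta r t + s i = s i + delta r t"
    using s_commutes_delta_far[of i r t] assms i by auto
qed

text \<open>For three points \<open>p < q < r\<close> the products \<open>a\<^sub>p\<^sub>q a\<^sub>q\<^sub>r\<close>, \<open>a\<^sub>q\<^sub>r a\<^sub>p\<^sub>r\<close> and \<open>a\<^sub>p\<^sub>r a\<^sub>p\<^sub>q\<close> coincide. The
  definition of bands yields one equation, the mirror formula the other.\<close>

lemma band_triangle1:
  assumes "1 \<le> p" "p < q" "q < r" "r \<le> N"
  shows "band p r + band p q = band p q + band q r"
proof -
  have c: "delta p (q - 1) + band q r = band q r + delta p (q - 1)"
    using delta_commutes_band[of q r p "q - 1"] assms by auto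
  have "band p r = delta p q + band q r - delta p q"
    using assms delta_split[of p q r] delta_split[of p q "r - 1"]
    unfolding band_def by (simp add: diff_conv_add_uminus minus_add add.assoc del: add_uminus_conv_diff)
  then have "band p r + delta p q = band p q + (delta p (q - 1) + band q r)"
    using band_add_delta[of p q] assms by (simp add: add.assoc[symmetric])
  then have "band p r + (band p q + delta p (q - 1)) = (band p q + band q r) + delta p (q - 1)"
    unfolding c band_add_delta[OF assms(2)] by (simp only: add.assoc)
  then show ?thesis
    by (simp only: add.assoc[symmetric] add_right_cancel)
qed

lemma band_triangle2:
  assumes "1 \<le> p" "p < q" "q < r" "r \<le> N"
  shows "band q r + band p r = band p q + band q r"
proof -
  have c: "delta (q + 1) r + band p q = band p q + delta (q + 1) r"
    using delta_commutes_band[of p q "q + 1" r] assms by auto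
  have d: "delta q r = delta (q + 1) r + band q r"
    using band_alt[of q r] assms by simp
  have "band p r = - delta q r + (band p q + delta q r)"
    using assms delta_split[of p q r] delta_split[of "p + 1" q r] band_alt[of p r] band_alt[of p q]
    by (simp add: minus_add add.assoc del: add_uminus_conv_diff)
  then have "delta q r + band p r = band p q + delta q r"
    by (simp add: add.assoc[symmetric])
  then have "delta (q + 1) r + (band q r + band p r) = delta (q + 1) r + (band p q + band q r)"
    unfolding d using c by (simp add: add.assoc[symmetric])
  then show ?thesis by simp
qed

text \<open>Conjugation by \<open>delta 1 n\<close> rotates the \<open>n\<close> points on the circle; the next lemma is the case of a chord
  whose endpoint \<open>n\<close> is carried to \<open>1\<close>.\<close>

lemma delta_band_shift:
  assumes "1 \<le> p" "p < q" "q < n" "n \<le> N"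
  shows "delta 1 n + band p q = band (p + 1) (q + 1) + delta 1 n"
proof -
  have A: "delta 1 n + delta p q = delta (p + 1) (q + 1) + delta 1 n"
   and B: "delta 1 n + delta p (q - 1) = delta (p + 1) q + delta 1 n"
    using assms delta_shift_delta[of 1 p q n] delta_shift_delta[of 1 p "q - 1" n] by auto
  have "delta 1 n + band p q + delta p (q - 1) = delta (p + 1) (q + 1) + delta 1 n"
    using A band_add_delta[of p q] assms by (simp add: add.assoc)
  also have "\<dots> = band (p + 1) (q + 1) + (delta (p + 1) q + delta 1 n)"
    using band_add_delta[of "p + 1" "q + 1"] assms by (simp add: add.assoc[symmetric])
  finally have "delta 1 n + band p q + delta p (q - 1) = band (p + 1) (q + 1) + delta 1 n + delta p (q - 1)"
    by (simp only: B[symmetric] add.assoc)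
  then show ?thesis by simp
qed

lemma delta_band_wrap:
  assumes "1 \<le> p" "p < n" "n \<le> N"
  shows "delta 1 n + band p n = band 1 (p + 1) + delta 1 n"
proof -
  have d: "delta 1 n = delta 1 (p + 1) + delta (p + 1) n" "delta 1 n = delta 1 p + delta p n"
    using assms by (auto intro!: delta_split)
  have "delta 1 n + band p n = delta 1 (p + 1) + delta p n"
    using assms band_alt[of p n] d(1) by (simp add: add.assoc)
  moreover have "band 1 (p + 1) + delta 1 n = delta 1 (p + 1) + delta p n"
    unfolding d(2) using band_add_delta[of 1 "p + 1"] assms by (simp add: add.assoc[symmetric])
  ultimately show ?thesis by simp
qed

end

section \<open>Words in chords\<close>

type_synonym chord = "nat \<times> nat"

text \<open>A pair \<open>p < q\<close> is thought of as the chord joining two of the points \<open>1, \<dots>, n\<close> on a circle. Keeping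
  track of the set \<open>I\<close> of admitted endpoints is what controls the index \<open>n - 1\<close>: a band involves it
  exactly when its chord ends at \<open>n\<close>.\<close>

definition chords :: "nat set \<Rightarrow> chord set" where
  "chords I = {(p, q). p \<in> I \<and> q \<in> I \<and> p < q}"

lemma chords_mono: "I \<subseteq> J \<Longrightarrow> chords I \<subseteq> chords J"
  by (auto simp: chords_def)

lemma chord_words_mono: "I \<subseteq> J \<Longrightarrow> w \<in> lists (chords I) \<Longrightarrow> w \<in> lists (chords J)"
  using lists_mono[OF chords_mono] by blast

context artin_generators
begin

abbreviation band' :: "chord \<Rightarrow> 'a" where
  "band' l \<equiv> band (fst l) (snd l)"

definition ev :: "chord list \<Rightarrow> 'a" where
  "ev w = sum_list (map band' w)"

lemma ev_simps [simp]: "ev [] = 0" "ev (l # w) = band' l + ev w" "ev (u @ w) = ev u + ev w"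
  by (simp_all add: ev_def)

text \<open>The elements that are products of bands and inverse bands with chords on \<open>I\<close>. The number \<open>m\<close> of factors
  is part of the relation because it enters the length bound.\<close>

inductive signed_word :: "nat set \<Rightarrow> nat \<Rightarrow> 'a \<Rightarrow> bool" for I where
  empty: "signed_word I 0 0"
| pos: "signed_word I m z \<Longrightarrow> l \<in> chords I \<Longrightarrow> signed_word I (Suc m) (band' l + z)"
| neg: "signed_word I m z \<Longrightarrow> l \<in> chords I \<Longrightarrow> signed_word I (Suc m) (- band' l + z)"

lemma signed_word_single:
  "l \<in> chords I \<Longrightarrow> signed_word I 1 (band' l)"
  "l \<in> chords I \<Longrightarrow> signed_word I 1 (- band' l)"
  using signed_word.pos[OF signed_word.empty, of l I] signed_word.neg[OF signed_word.empty, of l I]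
  by auto

lemma signed_word_append:
  "signed_word I m z \<Longrightarrow> signed_word I m' z' \<Longrightarrow> signed_word I (m + m') (z + z')"
  by (induction rule: signed_word.induct)
     (auto simp: add.assoc intro: signed_word.intros simp del: add_uminus_conv_diff)

lemma signed_word_mono: "signed_word I m z \<Longrightarrow> I \<subseteq> J \<Longrightarrow> signed_word J m z"
  by (induction rule: signed_word.induct) (use chords_mono in \<open>blast intro: signed_word.intros\<close>)+

lemma push_signed_word:
  assumes push: "\<And>l. l \<in> chords I \<Longrightarrow> \<exists>l'\<in>chords J. g + band' l = band' l' + g"
  assumes "signed_word I m z"
  shows "\<exists>z'. signed_word J m z' \<and> g + z = z' + g"
  using assms(2)
proof (induction rule: signed_word.induct)
  case empty
  show ?case using signed_word.empty by force
next
  case (pos m z l)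
  then obtain l' z' where "l' \<in> chords J" "g + band' l = band' l' + g"
    "signed_word J m z'" "g + z = z' + g"
    using push by meson
  then show ?case
    using push_add signed_word.pos by blast
next
  case (neg m z l)
  then obtain l' z' where "l' \<in> chords J" "g + band' l = band' l' + g"
    "signed_word J m z'" "g + z = z' + g"
    using push by meson
  then show ?case
    using push_add[OF push_minus] signed_word.neg by blast
qed

lemma push_word:
  assumes push: "\<And>l. l \<in> chords I \<Longrightarrow> \<exists>l'\<in>chords J. g + band' l = band' l' + g"
  assumes "w \<in> lists (chords I)"
  shows "\<exists>w'\<in>lists (chords J). length w' = length w \<and> g + ev w = ev w' + g"
  using assms(2)
proof (induction w)
  case Nil
  show ?case by force
next
  case (Cons l w)
  obtain l' where "l' \<in> chords J" "g + band' l = band' l' + g"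
    using push Cons.hyps(1) by blast
  moreover obtain w' where "w' \<in> lists (chords J)" "length w' = length w" "g + ev w = ev w' + g"
    using Cons.IH by blast
  ultimately show ?case
    by (intro bexI[of _ "l' # w'"]) (auto intro: push_add)
qed

text \<open>If no chord ends in \<open>p, \<dots>, q - 1\<close>, then a chord either misses or encloses the chord from \<open>p\<close> to
  \<open>q\<close>, and commutes with it, or it ends at \<open>q\<close>, and the triangle relations move this endpoint to \<open>p\<close>. This
  conjugation is the engine of the proof: with \<open>q = n\<close> it removes the endpoint \<open>n\<close>.\<close>

lemma push_band_outside:
  assumes pq: "1 \<le> p" "p < q" "q \<le> N" and I: "I \<subseteq> {1..N} - {p..<q}"
    and J: "\<And>i. i \<in> I \<Longrightarrow> i \<noteq> q \<Longrightarrow> i \<in> J" "q \<in> I \<Longrightarrow> p \<in> J"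
    and l: "l \<in> chords I"
  shows "\<exists>l'\<in>chords J. band p q + band' l = band' l' + band p q"
proof -
  obtain r t where l: "l = (r, t)" "r \<in> I" "t \<in> I" "r < t"
    using l by (auto simp: chords_def)
  have rt: "1 \<le> r" "t \<le> N" "r < p \<or> q \<le> r" "t < p \<or> q \<le> t"
    using I l by (auto simp: not_less)
  consider "t < p" | "r < p" "q < t" | "q < r" | "t = q" "r < p" | "r = q"
    using rt l pq by linarith
  then show ?thesis
  proof cases
    case 1
    then show ?thesis
      using band_commutes_below[of r t p q] pq rt l J by (intro bexI[of _ l]) (auto simp: chords_def)
  next
    case 2
    then show ?thesis
      using band_commutes_inside[of r p q t] pq rt l J by (intro bexI[of _ l]) (auto simp: chords_def)
  next
    case 3
    then show ?thesis
      using band_commutes_below[of p q r t] pq rt l J by (intro bexI[of _ l]) (auto simp: chords_def)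
  next
    case 4
    then show ?thesis
      using band_triangle2[of r p q] pq rt l J by (intro bexI[of _ "(r, p)"]) (auto simp: chords_def)
  next
    case 5
    then show ?thesis
      using band_triangle1[of p q t] pq rt l J by (intro bexI[of _ "(p, t)"]) (auto simp: chords_def)
  qed
qed

text \<open>The complementary situation: under a chord from \<open>p\<close> to \<open>q\<close> nothing crosses, and chords starting at
  \<open>p\<close> become chords ending at \<open>q\<close>.\<close>

lemma push_band_inside:
  assumes pq: "1 \<le> p" "p < q" "q \<le> N" and l: "l \<in> chords {p..<q}"
  shows "\<exists>l'\<in>chords {p<..q}. band p q + band' l = band' l' + band p q"
proof -
  obtain r t where l: "l = (r, t)" "p \<le> r" "r < t" "t < q"
    using l by (auto simp: chords_def)
  show ?thesis
  proof (cases "r = p")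
    case True
    then show ?thesis
      using band_triangle1[of p t q] band_triangle2[of p t q] pq l
      by (intro bexI[of _ "(t, q)"]) (auto simp: chords_def)
  next
    case False
    then show ?thesis
      using band_commutes_inside[of p r t q] pq l
      by (intro bexI[of _ l]) (auto simp: chords_def)
  qed
qed

fun rot :: "nat \<Rightarrow> chord \<Rightarrow> chord" where
  "rot n (p, q) = (if q < n then (p + 1, q + 1) else (1, p + 1))"

fun unrot :: "nat \<Rightarrow> chord \<Rightarrow> chord" where
  "unrot n (p, q) = (if p = 1 then (q - 1, n) else (p - 1, q - 1))"

lemma rot_chord: "l \<in> chords {1..n} \<Longrightarrow> rot n l \<in> chords {1..n}"
  by (auto simp: chords_def split: if_splits)

lemma unrot_chord: "l \<in> chords {1..n} \<Longrightarrow> unrot n l \<in> chords {1..n}"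
  by (auto simp: chords_def split: if_splits)

lemma rot_unrot: "l \<in> chords {1..n} \<Longrightarrow> rot n (unrot n l) = l"
  by (auto simp: chords_def split: if_splits)

lemma delta_rot:
  assumes "l \<in> chords {1..n}" "n \<le> N"
  shows "delta 1 n + band' l = band' (rot n l) + delta 1 n"
  using assms delta_band_shift[of "fst l" "snd l" n] delta_band_wrap[of "fst l" n]
  by (cases l) (auto simp: chords_def)

lemma delta_rot_word:
  assumes "w \<in> lists (chords {1..n})" "n \<le> N"
  shows "delta 1 n + ev w = ev (map (rot n) w) + delta 1 n"
  using assms(1)
proof (induction w)
  case (Cons l w)
  then show ?case using delta_rot[of l n] assms(2) push_add by simp
qed simp

lemma delta_unrot_word:
  assumes "w \<in> lists (chords {1..n})" "n \<le> N"
  shows "ev w + delta 1 n = delta 1 n + ev (map (unrot n) w)"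
proof -
  have "map (rot n) (map (unrot n) w) = w"
    using assms(1) rot_unrot by (induction w) auto
  moreover have "map (unrot n) w \<in> lists (chords {1..n})"
    using assms(1) unrot_chord by (induction w) auto
  ultimately show ?thesis
    using delta_rot_word assms(2) by metis
qed

lemma minus_delta_unrot:
  assumes "l \<in> chords {1..n}" "n \<le> N"
  shows "- delta 1 n + band' l = band' (unrot n l) + - delta 1 n"
proof -
  have "delta 1 n + band' (unrot n l) = band' l + delta 1 n"
    using delta_rot[OF unrot_chord] assms rot_unrot by metis
  then have "- delta 1 n + (band' l + delta 1 n) + - delta 1 n = band' (unrot n l) + - delta 1 n"
    by (metis minus_add_cancel)
  then show ?thesis
    by (simp add: add.assoc del: add_uminus_conv_diff)
qed

end

section \<open>Words with a prescribed sign of the last generator\<close>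

context artin_generators
begin

fun val_letter :: "braid_letter \<Rightarrow> 'a" where
  "val_letter (Sig i) = s i"
| "val_letter (SigInv i) = - s i"

definition val :: "braid_word \<Rightarrow> 'a" where
  "val u = sum_list (map val_letter u)"

lemma val_simps [simp]: "val [] = 0" "val (l # u) = val_letter l + val u" "val (u @ v) = val u + val v"
  by (simp_all add: val_def)

lemma val_delta: "val (map Sig [p..<q]) = delta p q"
  by (simp add: val_def delta_def o_def)

lemma val_inverse: "val (rev (map inv_letter u)) = - val u"
proof (induction u)
  case (Cons l u)
  then show ?case
    by (cases l) (simp_all add: minus_add)
qed simp

text \<open>The sign predicates concern only the letters of index \<open>n - 1\<close>, the largest one on \<open>n\<close> strands, and
  carry a bound \<open>m\<close> on the length of the word, so that signs and lengths are handled together.\<close>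

definition sigma_nonneg :: "nat \<Rightarrow> nat \<Rightarrow> 'a \<Rightarrow> bool" where
  "sigma_nonneg n m x \<longleftrightarrow> (\<exists>u\<in>braid_words n. val u = x \<and> length u \<le> m \<and> SigInv (n - 1) \<notin> set u)"

definition sigma_pos :: "nat \<Rightarrow> nat \<Rightarrow> 'a \<Rightarrow> bool" where
  "sigma_pos n m x \<longleftrightarrow> (\<exists>u\<in>braid_words n. val u = x \<and> length u \<le> m \<and> SigInv (n - 1) \<notin> set u
     \<and> Sig (n - 1) \<in> set u)"

definition sigma_nonpos :: "nat \<Rightarrow> nat \<Rightarrow> 'a \<Rightarrow> bool" where
  "sigma_nonpos n m x \<longleftrightarrow> (\<exists>u\<in>braid_words n. val u = x \<and> length u \<le> m \<and> Sig (n - 1) \<notin> set u)"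

definition sigma_neg :: "nat \<Rightarrow> nat \<Rightarrow> 'a \<Rightarrow> bool" where
  "sigma_neg n m x \<longleftrightarrow> (\<exists>u\<in>braid_words n. val u = x \<and> length u \<le> m \<and> Sig (n - 1) \<notin> set u
     \<and> SigInv (n - 1) \<in> set u)"

lemma sigma_nonneg_0 [simp]: "sigma_nonneg n m 0"
  by (auto simp: sigma_nonneg_def intro!: bexI[of _ "[]"])

lemma sigma_nonpos_0 [simp]: "sigma_nonpos n m 0"
  by (auto simp: sigma_nonpos_def intro!: bexI[of _ "[]"])

lemma sigma_pos_nonneg: "sigma_pos n m x \<Longrightarrow> sigma_nonneg n m x"
  by (auto simp: sigma_nonneg_def sigma_pos_def)

lemma sigma_neg_nonpos: "sigma_neg n m x \<Longrightarrow> sigma_nonpos n m x"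
  by (auto simp: sigma_nonpos_def sigma_neg_def)

lemma sigma_pos_mono: "sigma_pos n m x \<Longrightarrow> m \<le> m' \<Longrightarrow> sigma_pos n m' x"
  unfolding sigma_pos_def by (meson order_trans)

lemma sigma_neg_mono: "sigma_neg n m x \<Longrightarrow> m \<le> m' \<Longrightarrow> sigma_neg n m' x"
  unfolding sigma_neg_def by (meson order_trans)

lemma sigma_nonneg_add:
  assumes "sigma_nonneg n m x" "sigma_nonneg n m' x'"
  shows "sigma_nonneg n (m + m') (x + x')"
proof -
  obtain u u' where "u \<in> braid_words n" "val u = x" "length u \<le> m" "SigInv (n - 1) \<notin> set u"
    "u' \<in> braid_words n" "val u' = x'" "length u' \<le> m'" "SigInv (n - 1) \<notin> set u'"
    using assms by (auto simp: sigma_nonneg_def)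
  then show ?thesis
    unfolding sigma_nonneg_def by (intro bexI[of _ "u @ u'"]) auto
qed

lemma sigma_nonpos_add:
  assumes "sigma_nonpos n m x" "sigma_nonpos n m' x'"
  shows "sigma_nonpos n (m + m') (x + x')"
proof -
  obtain u u' where "u \<in> braid_words n" "val u = x" "length u \<le> m" "Sig (n - 1) \<notin> set u"
    "u' \<in> braid_words n" "val u' = x'" "length u' \<le> m'" "Sig (n - 1) \<notin> set u'"
    using assms by (auto simp: sigma_nonpos_def)
  then show ?thesis
    unfolding sigma_nonpos_def by (intro bexI[of _ "u @ u'"]) auto
qed

lemma sigma_pos_add_nonneg:
  assumes "sigma_pos n m x" "sigma_nonneg n m' x'"
  shows "sigma_pos n (m + m') (x + x')"
proof -
  obtain u u' where "u \<in> braid_words n" "val u = x" "length u \<le> m" "SigInv (n - 1) \<notin> set u"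
    "Sig (n - 1) \<in> set u"
    "u' \<in> braid_words n" "val u' = x'" "length u' \<le> m'" "SigInv (n - 1) \<notin> set u'"
    using assms by (auto simp: sigma_nonneg_def sigma_pos_def)
  then show ?thesis
    unfolding sigma_pos_def by (intro bexI[of _ "u @ u'"]) auto
qed

lemma sigma_nonneg_add_pos:
  assumes "sigma_nonneg n m x" "sigma_pos n m' x'"
  shows "sigma_pos n (m + m') (x + x')"
proof -
  obtain u u' where "u \<in> braid_words n" "val u = x" "length u \<le> m" "SigInv (n - 1) \<notin> set u"
    "Sig (n - 1) \<in> set u'"
    "u' \<in> braid_words n" "val u' = x'" "length u' \<le> m'" "SigInv (n - 1) \<notin> set u'"
    using assms by (auto simp: sigma_nonneg_def sigma_pos_def)
  then show ?thesis
    unfolding sigma_pos_def by (intro bexI[of _ "u @ u'"]) auto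
qed

lemma sigma_neg_add_nonpos:
  assumes "sigma_neg n m x" "sigma_nonpos n m' x'"
  shows "sigma_neg n (m + m') (x + x')"
proof -
  obtain u u' where "u \<in> braid_words n" "val u = x" "length u \<le> m" "Sig (n - 1) \<notin> set u"
    "SigInv (n - 1) \<in> set u"
    "u' \<in> braid_words n" "val u' = x'" "length u' \<le> m'" "Sig (n - 1) \<notin> set u'"
    using assms by (auto simp: sigma_nonpos_def sigma_neg_def)
  then show ?thesis
    unfolding sigma_neg_def by (intro bexI[of _ "u @ u'"]) auto
qed

lemma sigma_nonpos_add_neg:
  assumes "sigma_nonpos n m x" "sigma_neg n m' x'"
  shows "sigma_neg n (m + m') (x + x')"
proof -
  obtain u u' where "u \<in> braid_words n" "val u = x" "length u \<le> m" "Sig (n - 1) \<notin> set u"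
    "SigInv (n - 1) \<in> set u'"
    "u' \<in> braid_words n" "val u' = x'" "length u' \<le> m'" "Sig (n - 1) \<notin> set u'"
    using assms by (auto simp: sigma_nonpos_def sigma_neg_def)
  then show ?thesis
    unfolding sigma_neg_def by (intro bexI[of _ "u @ u'"]) auto
qed

definition band_word :: "nat \<Rightarrow> nat \<Rightarrow> braid_word" where
  "band_word p q = map Sig [p..<q] @ rev (map inv_letter (map Sig [p..<q - 1]))"

lemma val_band_word: "val (band_word p q) = band p q"
  by (simp only: band_word_def val_simps val_inverse val_delta band_def diff_conv_add_uminus)

lemma band_word_words: "1 \<le> p \<Longrightarrow> q \<le> n \<Longrightarrow> band_word p q \<in> braid_words n"
  by (auto simp: band_word_def braid_words_def)

lemma length_band_word: "1 \<le> p \<Longrightarrow> p < q \<Longrightarrow> q \<le> n \<Longrightarrow> length (band_word p q) \<le> 2 * n - 3"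
  by (auto simp: band_word_def)

lemma set_band_word:
  "Sig i \<in> set (band_word p q) \<longleftrightarrow> p \<le> i \<and> i < q"
  "SigInv i \<in> set (band_word p q) \<longleftrightarrow> p \<le> i \<and> i < q - 1"
  by (auto simp: band_word_def)

lemma sigma_pos_band:
  assumes "1 \<le> p" "p < n"
  shows "sigma_pos n (2 * n - 3) (band p n)"
  unfolding sigma_pos_def using assms length_band_word[of p n n]
  by (intro bexI[of _ "band_word p n"]) (auto simp: val_band_word band_word_words set_band_word)

text \<open>Bands on \<open>n - 1\<close> points do not involve the index \<open>n - 1\<close> at all; hence they count as nonnegative and
  as nonpositive, and their inverses may be used in nonnegative words.\<close>

lemma lower_band:
  assumes "l \<in> chords {1..n - 1}"
  shows "sigma_nonneg n (2 * n - 3) (band' l)" "sigma_nonneg n (2 * n - 3) (- band' l)"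
    "sigma_nonpos n (2 * n - 3) (band' l)"
proof -
  obtain p q where l: "l = (p, q)" "1 \<le> p" "p < q" "q < n"
    using assms by (auto simp: chords_def)
  let ?u = "band_word p q"
  let ?v = "rev (map inv_letter ?u)"
  have u: "val ?u = band' l" "?u \<in> braid_words n" "length ?u \<le> 2 * n - 3"
    "SigInv (n - 1) \<notin> set ?u" "Sig (n - 1) \<notin> set ?u"
    using l band_word_words[of p q n] length_band_word[of p q n]
    by (auto simp: val_band_word set_band_word)
  have v: "val ?v = - band' l"
    by (simp only: val_inverse u(1))
  have v': "?v \<in> braid_words n" "length ?v \<le> 2 * n - 3" "SigInv (n - 1) \<notin> set ?v"
    using l u(2,3) by (auto simp: braid_words_def band_word_def)
  show "sigma_nonneg n (2 * n - 3) (band' l)" "sigma_nonneg n (2 * n - 3) (- band' l)"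
    "sigma_nonpos n (2 * n - 3) (band' l)"
    unfolding sigma_nonneg_def sigma_nonpos_def using u v v' by blast+
qed

lemma sigma_nonneg_band:
  assumes "l \<in> chords {1..n}"
  shows "sigma_nonneg n (2 * n - 3) (band' l)"
proof (cases "snd l = n")
  case True
  then show ?thesis
    using assms sigma_pos_nonneg[OF sigma_pos_band[of "fst l" n]] by (auto simp: chords_def)
next
  case False
  then have "l \<in> chords {1..n - 1}"
    using assms by (auto simp: chords_def)
  then show ?thesis by (rule lower_band)
qed

lemma sigma_nonneg_ev:
  "w \<in> lists (chords {1..n}) \<Longrightarrow> sigma_nonneg n ((2 * n - 3) * length w) (ev w)"
proof (induction w)
  case (Cons l w)
  then show ?case
    using sigma_nonneg_add[OF sigma_nonneg_band, of l n "(2 * n - 3) * length w" "ev w"] by simp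
qed simp

lemma sigma_pos_ev:
  assumes "w \<in> lists (chords {1..n})" "w \<notin> lists (chords {1..n - 1})"
  shows "sigma_pos n ((2 * n - 3) * length w) (ev w)"
proof -
  obtain l where l: "l \<in> set w" "l \<notin> chords {1..n - 1}" "l \<in> chords {1..n}"
    using assms by (auto simp: lists_eq_set)
  then have n: "1 \<le> fst l" "fst l < n" "snd l = n"
    by (auto simp: chords_def)
  obtain u v where "w = u @ l # v"
    using split_list[OF l(1)] by blast
  then obtain p where l: "w = u @ (p, n) # v" "1 \<le> p" "p < n"
    using n by (cases l) auto
  have "sigma_pos n ((2 * n - 3) * length u + ((2 * n - 3) + (2 * n - 3) * length v)) (ev u + (band p n + ev v))"
    using assms(1) l
    by (intro sigma_nonneg_add_pos sigma_pos_add_nonneg sigma_nonneg_ev sigma_pos_band) auto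
  then show ?thesis
    by (simp add: l add_mult_distrib2 add.left_commute)
qed

lemma sigma_nonpos_ev:
  "w \<in> lists (chords {1..n - 1}) \<Longrightarrow> sigma_nonpos n ((2 * n - 3) * length w) (ev w)"
proof (induction w)
  case (Cons l w)
  then show ?case
    using sigma_nonpos_add[OF lower_band(3), of l n "(2 * n - 3) * length w" "ev w"] by simp
qed simp

lemma sigma_nonneg_signed_word:
  "signed_word {1..n - 1} k z \<Longrightarrow> sigma_nonneg n ((2 * n - 3) * k) z"
proof (induction rule: signed_word.induct)
  case (pos m z l)
  then show ?case
    using sigma_nonneg_add[OF lower_band(1)[of l n], of "(2 * n - 3) * m" z] by simp
next
  case (neg m z l)
  then show ?case
    using sigma_nonneg_add[OF lower_band(2)[of l n], of "(2 * n - 3) * m" z] by simp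
qed simp

lemma minus_delta_words:
  assumes "2 \<le> n"
  shows "sigma_nonneg n (n - 2) (- delta 1 (n - 1))" "sigma_neg n (n - 1) (- delta 1 n)"
proof -
  have v: "val (rev (map inv_letter (map Sig [1..<m]))) = - delta 1 m" for m
    by (simp only: val_inverse val_delta)
  show "sigma_nonneg n (n - 2) (- delta 1 (n - 1))"
    unfolding sigma_nonneg_def
    by (rule bexI[of _ "rev (map inv_letter (map Sig [1..<n - 1]))"], intro conjI, rule v)
       (use assms in \<open>auto simp: braid_words_def\<close>)
  show "sigma_neg n (n - 1) (- delta 1 n)"
    unfolding sigma_neg_def
    by (rule bexI[of _ "rev (map inv_letter (map Sig [1..<n]))"], intro conjI, rule v)
       (use assms in \<open>auto simp: braid_words_def image_iff\<close>)
qed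

end

section \<open>Lower bounds for tails\<close>

text \<open>The bound \<open>f\<close> stands for the set of points \<open>1, \<dots>, f - 1, n\<close>. Reading a positive word from right to
  left, a letter with chord from \<open>r\<close> to \<open>q\<close> replaces \<open>f\<close> by \<open>r + 1\<close> if \<open>r < f \<le> q\<close>, and leaves it unchanged
  otherwise; see \<open>above_letter\<close>. The value \<open>f = n\<close> encodes the exceptional start with the inverse of
  \<open>band (n - 1) n\<close>, with which, among the bands on \<open>n - 1\<close> points, only those ending at \<open>n - 1\<close> do not commute; hence the
  minimum.\<close>

definition lower :: "nat \<Rightarrow> chord \<Rightarrow> nat \<Rightarrow> nat" where
  "lower n l f = (if fst l < f \<and> min f (n - 1) \<le> snd l then fst l + 1 else f)"

lemma foldr_lower_le: "foldr (lower n) x f \<le> f"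
  by (induction x) (auto simp: lower_def intro: order_trans)

lemma foldr_lower_ge2:
  "x \<in> lists (chords {1..m}) \<Longrightarrow> 2 \<le> f \<Longrightarrow> 2 \<le> foldr (lower n) x f"
  by (induction x) (auto simp: lower_def chords_def)

text \<open>The combinatorial heart of the ladder argument. Call a letter low if it lies entirely below the
  current bound. Without low letters every letter starts at the final bound minus one or later. The
  last low letter, on the other hand, ends no later than any subsequent letter starts, and can thus be
  pushed to the right end of the word.\<close>

lemma walk_alternatives:
  obtains "\<And>l. l \<in> set x \<Longrightarrow> foldr (lower n) x f \<le> fst l + 1"
  | u r t v where "x = u @ (r, t) # v" "t < min f (n - 1)" "\<And>l. l \<in> set v \<Longrightarrow> t \<le> fst l"
proof -
  have "(\<forall>l\<in>set x. foldr (lower n) x f \<le> fst l + 1) \<or>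
    (\<exists>u r t v. x = u @ (r, t) # v \<and> t < min f (n - 1) \<and> (\<forall>l\<in>set v. t \<le> fst l))"
  proof (induction x)
    case (Cons l x)
    define g where "g = foldr (lower n) x f"
    have g: "foldr (lower n) (l # x) f = lower n l g" "g \<le> f"
      using foldr_lower_le by (simp_all add: g_def)
    consider (later) u r t v where "x = u @ (r, t) # v" "t < min f (n - 1)" "\<forall>l\<in>set v. t \<le> fst l"
      | (all) "\<forall>l\<in>set x. g \<le> fst l + 1"
      using Cons.IH unfolding g_def by blast
    then show ?case
    proof cases
      case later
      then have "l # x = (l # u) @ (r, t) # v" by simp
      then show ?thesis using later by blast
    next
      case all
      show ?thesis
      proof (cases "fst l < g \<and> \<not> min g (n - 1) \<le> snd l")
        case True
        have "snd l < min f (n - 1)"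
          using True g(2) by auto
        moreover have "snd l \<le> fst l'" if "l' \<in> set x" for l'
          using all that True by fastforce
        moreover have "l # x = [] @ (fst l, snd l) # x" by simp
        ultimately show ?thesis by blast
      next
        case False
        then have "lower n l g \<le> fst l + 1" "lower n l g \<le> g"
          by (auto simp: lower_def)
        then show ?thesis
          unfolding g(1) using all by force
      qed
    qed
  qed simp
  then show ?thesis using that by blast
qed

context artin_generators
begin

text \<open>In terms of Dehornoy's ordering, this is a lower bound for \<open>Z\<close>, which is the weaker the larger \<open>f\<close> is:
  all the negative letters of index \<open>n - 1\<close> needed to spell \<open>Z\<close> can be put in front, in a signed word on
  the points \<open>1, \<dots>, f - 1, n\<close>, or, for \<open>f = n\<close>, in the inverse of the last generator. The factor
  \<open>2 n - 3\<close> is the maximal length of a band.\<close>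

definition above :: "nat \<Rightarrow> nat \<Rightarrow> nat \<Rightarrow> 'a \<Rightarrow> bool" where
  "above n f m Z \<longleftrightarrow> (\<exists>z k x t. Z = z + x \<and> sigma_nonneg n t x \<and> (2 * n - 3) * k + t \<le> m \<and>
     (if f < n then signed_word (insert n {1..<f}) k z else k = 1 \<and> z = - band (n - 1) n))"

lemma aboveI:
  "signed_word (insert n {1..<f}) k z \<Longrightarrow> sigma_nonneg n t x \<Longrightarrow> (2 * n - 3) * k + t \<le> m \<Longrightarrow> f < n
    \<Longrightarrow> Z = z + x \<Longrightarrow> above n f m Z"
  unfolding above_def by auto

lemma above_topI:
  "sigma_nonneg n t x \<Longrightarrow> (2 * n - 3) + t \<le> m \<Longrightarrow> Z = - band (n - 1) n + x \<Longrightarrow> above n n m Z"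
  unfolding above_def
  by (rule exI[of _ "- band (n - 1) n"], rule exI[of _ 1], rule exI[of _ x], rule exI[of _ t]) simp

lemma above_mono:
  assumes "above n f m Z" "f \<le> p" "p < n" "m \<le> m'"
  shows "above n p m' Z"
proof -
  obtain z k x t where Z: "Z = z + x" "sigma_nonneg n t x" "(2 * n - 3) * k + t \<le> m"
    and z: "signed_word (insert n {1..<f}) k z"
    using assms by (auto simp: above_def)
  have "signed_word (insert n {1..<p}) k z"
    by (rule signed_word_mono[OF z]) (use assms in auto)
  then show ?thesis
    by (rule aboveI[OF _ Z(2)]) (use assms Z in auto)
qed

text \<open>A low letter is absorbed into the signed word and a letter starting at \<open>f\<close> or later commutes with it.
  In the remaining case \<open>r < f \<le> q\<close> the signed word \<open>z\<close> is first traded for a single inverse band: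
  \<open>z\<close> is a conjugate of a word on fewer strands by \<open>band q n\<close>, and the negative one of the two conjugating
  letters passes the given letter as the inverse of \<open>band r n\<close>. This costs two additional bands.\<close>

lemma above_letter:
  assumes l: "l \<in> chords {1..n - 1}" and f: "f \<le> n" and n: "n \<le> N" and Z: "above n f m Z"
  shows "above n (lower n l f) (m + 3 * (2 * n - 3)) (band' l + Z)"
proof -
  let ?c = "2 * n - 3"
  obtain r q where l': "l = (r, q)" "1 \<le> r" "r < q" "q < n"
    using l by (auto simp: chords_def)
  obtain z k x t where Z: "Z = z + x" "sigma_nonneg n t x" "?c * k + t \<le> m"
    and z: "if f < n then signed_word (insert n {1..<f}) k z else k = 1 \<and> z = - band (n - 1) n"
    using Z by (auto simp: above_def)
  have lx: "sigma_nonneg n (?c + t) (band' l + x)"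
    using lower_band(1)[OF l] Z(2) by (rule sigma_nonneg_add)
  have cross: "band r q - band q n = - band r n + band r q"
    using push_minus[of "band r q" "band q n" "band r n"] band_triangle1[of r q n] l' n by simp
  have rn: "signed_word (insert n {1..<r + 1}) 1 (- band r n)"
    using signed_word_single(2)[of "(r, n)"] l' by (simp add: chords_def)
  show ?thesis
  proof (cases "f < n")
    case True
    note z = z[unfolded if_P[OF True]]
    consider (contact) "r < f" "f \<le> q" | (low) "q < f" | (high) "f \<le> r"
      using l' by linarith
    then show ?thesis
    proof cases
      \<comment> \<open>the signed word is conjugated by \<open>band q n\<close> into the group on \<open>n - 1\<close> strands\<close>
      case contact
      have "\<exists>z'. signed_word {1..n - 1} k z' \<and> band q n + z = z' + band q n"
        by (rule push_signed_word[OF _ z], rule push_band_outside) (use contact l' n in auto)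
      then obtain z' where z': "signed_word {1..n - 1} k z'" "band q n + z = z' + band q n"
        by blast
      have qn: "sigma_nonneg n ?c (band q n)"
        using sigma_pos_nonneg sigma_pos_band[of q n] l' by simp
      have s1: "sigma_nonneg n (?c + (?c * k + (?c + t))) (band r q + (z' + (band q n + x)))"
        using sigma_nonneg_signed_word[OF z'(1)] lower_band(1)[OF l] qn Z(2) l'
        by (intro sigma_nonneg_add) auto
      have s2: "band' l + Z = - band r n + (band r q + (z' + (band q n + x)))"
      proof -
        have "band r q + (z + x) = (band r q + - band q n) + ((band q n + z) + x)"
          by (simp add: add.assoc del: add_uminus_conv_diff)
        also have "\<dots> = (- band r n + band r q) + ((z' + band q n) + x)"
          using cross z'(2) by simp
        finally show ?thesis
          by (simp add: Z(1) l' add.assoc)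
      qed
      have s3: "lower n l f = r + 1"
        using contact l' by (simp add: lower_def)
      show ?thesis
        unfolding s2 s3 by (rule aboveI[OF rn s1]) (use Z(3) l' in auto)
    next
      case low
      then have "l \<in> chords (insert n {1..<f})"
        using l' by (auto simp: chords_def)
      then have "signed_word (insert n {1..<f}) (Suc k) (band' l + z)"
        using signed_word.pos z by blast
      moreover have "lower n l f = f"
        using low l' True by (simp add: lower_def)
      ultimately show ?thesis
        using True Z by (auto intro!: aboveI simp: add.assoc)
    next
      case high
      have "\<exists>z'. signed_word (insert n {1..<f}) k z' \<and> band r q + z = z' + band r q"
        by (rule push_signed_word[OF _ z], rule push_band_outside) (use high l' n in auto)
      then obtain z' where z': "signed_word (insert n {1..<f}) k z'" "band r q + z = z' + band r q"
        by blast
      have "lower n l f = f"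
        using high l' by (simp add: lower_def)
      moreover have "band' l + Z = z' + (band' l + x)"
        using z'(2) by (simp add: Z(1) l' add.assoc[symmetric])
      ultimately show ?thesis
        using True Z(3) by (auto intro!: aboveI[OF z'(1) lx])
    qed
  next
    case False
    then have z: "k = 1" "z = - band (n - 1) n" and f: "f = n"
      using z f by auto
    show ?thesis
    proof (cases "q = n - 1")
      case True
      then have s1: "lower n l f = r + 1"
        using l' f by (simp add: lower_def)
      have s2: "band' l + Z = - band r n + (band' l + x)"
        using cross True by (simp add: Z(1) z l' add.assoc[symmetric])
      show ?thesis
        unfolding s1 s2 by (rule aboveI[OF rn lx]) (use Z(3) l' z in auto)
    next
      case False
      then have s1: "lower n l f = n"
        using l' f by (simp add: lower_def)
      have "band r q + z = z + band r q"
        unfolding z using band_commutes_below[of r q "n - 1" n] False l' n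
        by (intro push_minus) auto
      then have s2: "band' l + Z = - band (n - 1) n + (band' l + x)"
        by (simp add: Z(1) z l' add.assoc[symmetric])
      show ?thesis
        unfolding s1 s2 by (rule above_topI[OF lx]) (use Z(3) z in auto)
    qed
  qed
qed

lemma above_walk:
  assumes "x \<in> lists (chords {1..n - 1})" "f \<le> n" "n \<le> N" "above n f m Z"
  shows "above n (foldr (lower n) x f) (m + 3 * (2 * n - 3) * length x) (ev x + Z)"
  using assms(1)
proof (induction x)
  case (Cons l x)
  then have "above n (lower n l (foldr (lower n) x f)) (m + 3 * (2 * n - 3) * length x + 3 * (2 * n - 3)) (band' l + (ev x + Z))"
    using assms foldr_lower_le[of n x f] by (intro above_letter) auto
  then show ?case
    by (simp add: add.assoc) (simp add: ac_simps)
qed (use assms in simp)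

lemma delta_last: "2 \<le> n \<Longrightarrow> delta 1 n = delta 1 (n - 1) + band (n - 1) n"
  using delta_Suc[of 1 "n - 1"] delta_Suc[of "n - 1" "n - 1"] by (simp add: band_def)

text \<open>If the rotated positive part ends with \<open>band e (n - 1)\<close>, then before the rotation it ended with
  \<open>band (e + 1) n\<close>, so that \<open>e + 1\<close> is the bound known for the old tail. Moving the signed word
  through the inverse of \<open>\<delta>\<close> turns its points \<open>1, \<dots>, e, n\<close> into \<open>1, \<dots>, e - 1, n - 1, n\<close>, which also accommodates the new inverse of
  the last generator; the letter \<open>band e (n - 1)\<close> then moves the point \<open>n - 1\<close> to \<open>e\<close>.\<close>

lemma above_last:
  assumes e: "1 \<le> e" "e + 1 < n" and n: "n \<le> N" and Z: "above n (e + 1) m Z"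
  shows "above n (e + 1) (m + 2 * (2 * n - 3) + (n - 2)) (band e (n - 1) - delta 1 n + Z)"
proof -
  let ?c = "2 * n - 3" and ?J = "insert (n - 1) (insert n {1..<e})"
  obtain z k x t where Z: "Z = z + x" "sigma_nonneg n t x" "?c * k + t \<le> m"
    and z: "signed_word (insert n {1..<e + 1}) k z"
    using Z e by (auto simp: above_def)
  have "\<exists>l'\<in>chords ?J. - delta 1 n + band' l = band' l' + - delta 1 n"
    if l: "l \<in> chords (insert n {1..<e + 1})" for l
  proof (rule bexI)
    show "- delta 1 n + band' l = band' (unrot n l) + - delta 1 n"
      using l e n by (intro minus_delta_unrot) (auto simp: chords_def)
    show "unrot n l \<in> chords ?J"
      using l e by (auto simp: chords_def split: if_splits)
  qed
  from push_signed_word[OF this z] obtain z1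
    where z1: "signed_word ?J k z1" "- delta 1 n + z = z1 + - delta 1 n"
    by blast
  have "(n - 1, n) \<in> chords ?J"
    using e by (auto simp: chords_def)
  from signed_word_append[OF z1(1) signed_word_single(2)[OF this]]
  have z2: "signed_word ?J (k + 1) (z1 + - band (n - 1) n)" by simp
  \<comment> \<open>conjugation by \<open>band e (n - 1)\<close> moves the point \<open>n - 1\<close> to \<open>e\<close>\<close>
  have "\<exists>z3. signed_word (insert n {1..<e + 1}) (k + 1) z3 \<and>
      band e (n - 1) + (z1 + - band (n - 1) n) = z3 + band e (n - 1)"
    by (rule push_signed_word[OF _ z2], rule push_band_outside) (use e n in auto)
  then obtain z3 where z3: "signed_word (insert n {1..<e + 1}) (k + 1) z3"
    "band e (n - 1) + (z1 + - band (n - 1) n) = z3 + band e (n - 1)"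
    by blast
  have s1: "sigma_nonneg n (?c + ((n - 2) + t)) (band e (n - 1) + (- delta 1 (n - 1) + x))"
  proof (intro sigma_nonneg_add)
    show "sigma_nonneg n ?c (band e (n - 1))"
    proof -
      have "(e, n - 1) \<in> chords {1..n - 1}"
        using e by (auto simp: chords_def)
      from lower_band(1)[OF this] show ?thesis by simp
    qed
  qed (use minus_delta_words(1)[of n] Z(2) e in simp_all)
  have s2: "band e (n - 1) - delta 1 n + Z = z3 + (band e (n - 1) + (- delta 1 (n - 1) + x))"
  proof -
    have d: "- delta 1 n = - band (n - 1) n + - delta 1 (n - 1)"
      using e by (simp only: delta_last minus_add)
    have "band e (n - 1) - delta 1 n + Z = band e (n - 1) + ((- delta 1 n + z) + x)"
      by (simp add: Z(1) add.assoc diff_conv_add_uminus del: add_uminus_conv_diff)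
    also have "\<dots> = (band e (n - 1) + (z1 + - band (n - 1) n)) + (- delta 1 (n - 1) + x)"
      by (simp only: z1(2)) (simp only: d add.assoc)
    finally show ?thesis
      unfolding z3(2) by (simp only: add.assoc)
  qed
  show ?thesis
    unfolding s2 by (rule aboveI[OF z3(1) s1]) (use Z(3) e in \<open>simp_all add: add_mult_distrib2\<close>)
qed

text \<open>Pushing \<open>band p n\<close> through the signed word replaces the endpoint \<open>n\<close> by \<open>p\<close>, which removes all negative
  letters of index \<open>n - 1\<close> and keeps the positive letter of \<open>band p n\<close>.\<close>

lemma above_sigma_pos:
  assumes p: "1 \<le> p" "p < n" and n: "n \<le> N" and Z: "above n p m Z"
  shows "sigma_pos n (m + (2 * n - 3)) (band p n + Z)"
proof -
  obtain z k x t where Z: "Z = z + x" "sigma_nonneg n t x" "(2 * n - 3) * k + t \<le> m"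
    and z: "signed_word (insert n {1..<p}) k z"
    using Z p by (auto simp: above_def)
  have "\<exists>z'. signed_word {1..n - 1} k z' \<and> band p n + z = z' + band p n"
    by (rule push_signed_word[OF _ z], rule push_band_outside) (use p n in auto)
  then obtain z' where z': "signed_word {1..n - 1} k z'" "band p n + z = z' + band p n"
    by blast
  have "sigma_pos n ((2 * n - 3) * k + ((2 * n - 3) + t)) (z' + (band p n + x))"
    using sigma_nonneg_signed_word[OF z'(1)] sigma_pos_band[of p n] Z(2) p
    by (intro sigma_nonneg_add_pos sigma_pos_add_nonneg) auto
  moreover have "band p n + Z = z' + (band p n + x)"
    using z'(2) by (simp add: Z(1) add.assoc[symmetric])
  ultimately show ?thesis
    using Z(3) by (auto intro: sigma_pos_mono)
qed

end

section \<open>Peeling off the part on fewer strands\<close>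

context artin_generators
begin

text \<open>Right divisibility by a band in the monoid of positive words. The condition on the lengths replaces
  the length function of that monoid.\<close>

definition right_letter :: "nat \<Rightarrow> chord list \<Rightarrow> chord \<Rightarrow> bool" where
  "right_letter n w l \<longleftrightarrow> (\<exists>v\<in>lists (chords {1..n}). l \<in> chords {1..n} \<and>
     length w = Suc (length v) \<and> ev w = ev v + band' l)"

text \<open>Maximality of the factors is used only through this property of the other factor: each band dividing
  it from the right has \<open>m\<close> as an endpoint.\<close>

definition ends_at :: "nat \<Rightarrow> nat \<Rightarrow> chord list \<Rightarrow> bool" where
  "ends_at n m w \<longleftrightarrow> (\<forall>l. right_letter n w l \<longrightarrow> fst l = m \<or> snd l = m)"

lemma ends_atD: "ends_at n m w \<Longrightarrow> right_letter n w (p, q) \<Longrightarrow> p = m \<or> q = m"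
  by (auto simp: ends_at_def)

lemma split_tail:
  assumes "w \<in> lists (chords {1..n})"
  obtains h x where "h \<in> lists (chords {1..n})" "x \<in> lists (chords {1..n - 1})" "ends_at n n h"
    "ev w = ev h + ev x" "length w = length h + length x"
proof -
  have "\<exists>h\<in>lists (chords {1..n}). \<exists>x\<in>lists (chords {1..n - 1}).
    ends_at n n h \<and> ev w = ev h + ev x \<and> length w = length h + length x"
    using assms
  proof (induction "length w" arbitrary: w)
    case 0
    then show ?case
      by (intro bexI[of _ "[]"]) (auto simp: ends_at_def right_letter_def)
  next
    case (Suc k)
    show ?case
    proof (cases "ends_at n n w")
      case True
      then show ?thesis
        using Suc.prems by (intro bexI[of _ w] bexI[of _ "[]"]) auto
    next
      case False
      then obtain l where r: "right_letter n w l" and l: "fst l \<noteq> n" "snd l \<noteq> n"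
        unfolding ends_at_def by blast
      then obtain v where l': "l \<in> chords {1..n}" and v: "v \<in> lists (chords {1..n})" "length w = Suc (length v)" "ev w = ev v + band' l"
        unfolding right_letter_def by blast
      obtain h x where hx: "h \<in> lists (chords {1..n})" "x \<in> lists (chords {1..n - 1})"
        "ends_at n n h" "ev v = ev h + ev x" "length v = length h + length x"
        using Suc.hyps v by (metis Suc_inject)
      have "x @ [l] \<in> lists (chords {1..n - 1})"
        using hx(2) l l' by (auto simp: chords_def)
      moreover have "ev w = ev h + ev (x @ [l])" "length w = length h + length (x @ [l])"
        using v hx by (auto simp: add.assoc)
      ultimately show ?thesis
        using hx by blast
    qed
  qed
  then show ?thesis
    using that by blast
qed

lemma right_letter_rot:
  assumes h: "h \<in> lists (chords {1..n})" and n: "n \<le> N"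
    and r: "right_letter n (map (unrot n) h) l"
  shows "right_letter n h (rot n l)"
proof -
  obtain v where v: "v \<in> lists (chords {1..n})" "l \<in> chords {1..n}"
    "length h = Suc (length v)" "ev (map (unrot n) h) = ev v + band' l"
    using r by (auto simp: right_letter_def)
  have "ev h + delta 1 n = delta 1 n + (ev v + band' l)"
    using delta_unrot_word[OF h n] v by simp
  also have "\<dots> = (ev (map (rot n) v) + band' (rot n l)) + delta 1 n"
    by (rule push_add) (use v n delta_rot delta_rot_word in auto)
  finally have "ev h = ev (map (rot n) v) + band' (rot n l)"
    by simp
  moreover have "map (rot n) v \<in> lists (chords {1..n})"
    using v(1) rot_chord by (induction v) auto
  ultimately show ?thesis
    unfolding right_letter_def using v rot_chord by (intro bexI[of _ "map (rot n) v"]) auto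
qed

text \<open>Rotation shifts the distinguished point. After splitting once more, the rotated word \<open>h\<^sub>2 x\<close> ends
  at \<open>n - 1\<close> while its first factor \<open>h\<^sub>2\<close> ends at \<open>n\<close>; the interplay of the two conditions forces the
  structure of \<open>x\<close>.\<close>

lemma ends_at_unrot:
  assumes "h \<in> lists (chords {1..n})" "n \<le> N" "2 \<le> n" "ends_at n n h"
  shows "ends_at n (n - 1) (map (unrot n) h)"
  unfolding ends_at_def
proof (intro allI impI)
  fix l assume r: "right_letter n (map (unrot n) h) l"
  then have "l \<in> chords {1..n}"
    by (auto simp: right_letter_def)
  moreover have "fst (rot n l) = n \<or> snd (rot n l) = n"
    using right_letter_rot[OF assms(1,2) r] assms(4) by (auto simp: ends_at_def)
  ultimately show "fst l = n - 1 \<or> snd l = n - 1"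
    using assms(3) by (cases l) (auto simp: chords_def split: if_splits)
qed

text \<open>The left fraction with numerator \<open>y\<close> and the \<open>k\<close>-th power of \<open>delta 1 n\<close> as denominator.\<close>

definition over_delta :: "nat \<Rightarrow> nat \<Rightarrow> 'a \<Rightarrow> 'a" where
  "over_delta n k y = (((+) (- delta 1 n)) ^^ k) y"

lemma over_delta_simps [simp]:
  "over_delta n 0 y = y"
  "over_delta n (Suc k) y = - delta 1 n + over_delta n k y"
  by (simp_all add: over_delta_def)

lemma sigma_nonneg_over_delta:
  assumes "x \<in> lists (chords {1..n})" "2 \<le> n"
  shows "sigma_nonneg n ((2 * n - 3) * length x + i * (n - 2)) (over_delta (n - 1) i (ev x))"
proof (induction i)
  case 0
  show ?case using sigma_nonneg_ev[OF assms(1)] by simp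
next
  case (Suc i)
  show ?case
    using sigma_nonneg_add[OF minus_delta_words(1)[OF assms(2)] Suc.IH] by (simp add: ac_simps)
qed

text \<open>The situation after \<open>i\<close> rounds: \<open>h\<close> is what remains of the positive part, \<open>M\<close> bands have gone into the
  tail \<open>Z\<close>, and \<open>x1\<close> is the first factor split off. The lower bound for \<open>Z\<close> depends on how \<open>h\<close> ends. The
  disjunct \<open>p = n - 1\<close> describes the exceptional tails, for which the braid may come from fewer
  strands. The condition \<open>2 \<le> p\<close> shows in the next round that, as long as \<open>h\<close> is
  not used up, a factor \<open>x\<close> can be empty only in the first round.\<close>

definition tail_invariant :: "nat \<Rightarrow> chord list \<Rightarrow> nat \<Rightarrow> nat \<Rightarrow> chord list \<Rightarrow> 'a \<Rightarrow> bool" where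
  "tail_invariant n x1 M i h Z \<longleftrightarrow>
     h \<in> lists (chords {1..n}) \<and> ends_at n n h \<and>
     x1 \<in> lists (chords {1..n - 1}) \<and> length x1 \<le> M \<and>
     sigma_nonpos n ((2 * n - 3) * M + i * (n - 1)) Z \<and>
     (if i = 0 then Z = ev x1 else sigma_neg n ((2 * n - 3) * M + i * (n - 1)) Z) \<and>
     (\<forall>p. right_letter n h (p, n) \<longrightarrow> (i = 0 \<or> 2 \<le> p) \<and>
        (above n p (3 * (2 * n - 3) * M + i * ((2 * n - 3) + (n - 2))) Z \<or>
         p = n - 1 \<and> Z = - band (n - 1) n + over_delta (n - 1) i (ev x1)))"

text \<open>Suppose the walk along \<open>x\<close> does not bring the bound down to \<open>p\<close>. Then either a low letter can be pushed
  to the end of \<open>g\<close>, or all letters of \<open>x\<close> lie under the chord from \<open>p\<close> to \<open>n\<close> and this chord can be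
  pushed to the end. Both contradict that \<open>g\<close> ends at \<open>n - 1\<close>, except when \<open>p = n - 1\<close> leaves no room
  for letters of \<open>x\<close>.\<close>

lemma ladder:
  assumes n: "3 \<le> n" "n \<le> N"
    and h: "h \<in> lists (chords {1..n})" and x: "x \<in> lists (chords {1..n - 1})" "e + 1 < n" "1 \<le> e"
    and g: "ends_at n (n - 1) g" "ev g = ev h + ev (x @ [(e, n - 1)])" "length g = length h + Suc (length x)"
    and f: "f = e + 1 \<or> f = n \<and> e = n - 2"
    and p: "right_letter n h (p, n)"
  shows "foldr (lower n) x f \<le> p \<or> x = [] \<and> f = n \<and> p = n - 1"
proof (rule ccontr)
  assume neg: "\<not> ?thesis"
  let ?l = "(e, n - 1)"
  have l: "?l \<in> chords {1..n - 1}"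
    using x by (auto simp: chords_def)
  have xn: "x \<in> lists (chords {1..n})"
    using x(1) chord_words_mono[of "{1..n - 1}" "{1..n}"] by auto
  obtain v where v: "v \<in> lists (chords {1..n})" "1 \<le> p" "p < n"
    "length h = Suc (length v)" "ev h = ev v + band p n"
    using p by (auto simp: right_letter_def chords_def)
  show False
  proof (rule walk_alternatives[of x n f])
    fix u r t w
    assume a: "x = u @ (r, t) # w" "t < min f (n - 1)" "\<And>l. l \<in> set w \<Longrightarrow> t \<le> fst l"
    \<comment> \<open>the last low letter passes the rest of \<open>x\<close> and also the final letter, as \<open>t \<le> e\<close>\<close>
    have rt: "1 \<le> r" "r < t" "t < n - 1"
      using a x(1) by (auto simp: chords_def)
    have "t \<le> e"
      using a(2) f n by auto
    have "l \<in> chords {t..n - 1}" if "l \<in> set (w @ [?l])" for l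
    proof -
      have "l \<in> chords {1..n - 1}" "t \<le> fst l"
        using that a(1) a(3)[of l] x(1) l \<open>t \<le> e\<close> by auto
      then show ?thesis by (auto simp: chords_def)
    qed
    then have "w @ [?l] \<in> lists (chords {t..n - 1})"
      by blast
    moreover have "\<exists>l'\<in>chords {1..n - 1}. band r t + band' l = band' l' + band r t"
      if "l \<in> chords {t..n - 1}" for l
      by (rule push_band_outside[OF _ _ _ _ _ _ that]) (use rt n in auto)
    ultimately obtain w' where w': "w' \<in> lists (chords {1..n - 1})" "length w' = length (w @ [?l])"
      "band r t + ev (w @ [?l]) = ev w' + band r t"
      using push_word by meson
    have "ev g = ev (h @ u @ w') + band r t"
      using g(2) w'(3) a(1) by (simp add: add.assoc)
    moreover have "w' \<in> lists (chords {1..n})"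
      using w'(1) chord_words_mono[of "{1..n - 1}" "{1..n}"] by auto
    ultimately have "right_letter n g (r, t)"
      unfolding right_letter_def using g(3) w'(2) a(1) h xn rt
      by (intro bexI[of _ "h @ u @ w'"]) (auto simp: chords_def)
    then show False
      using ends_atD[OF g(1)] rt by fastforce
  next
    \<comment> \<open>no low letters: all letters of \<open>x\<close> start at \<open>p\<close> or later\<close>
    assume a: "\<And>l. l \<in> set x \<Longrightarrow> foldr (lower n) x f \<le> fst l + 1"
    have px: "p \<le> fst l" if "l \<in> set x" for l
      using neg a[OF that] by auto
    show False
    proof (cases "p \<le> e")
      case True
      have "l \<in> chords {p..<n}" if "l \<in> set (x @ [?l])" for l
      proof -
        have "l \<in> chords {1..n - 1}" "p \<le> fst l"
          using that px[of l] x(1) l True by auto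
        then show ?thesis using n by (auto simp: chords_def)
      qed
      then have "x @ [?l] \<in> lists (chords {p..<n})"
        by blast
      moreover have "\<exists>l'\<in>chords {p<..n}. band p n + band' l = band' l' + band p n"
        if "l \<in> chords {p..<n}" for l
        using push_band_inside[OF v(2,3) n(2) that] .
      ultimately obtain w' where w': "w' \<in> lists (chords {p<..n})" "length w' = length (x @ [?l])"
        "band p n + ev (x @ [?l]) = ev w' + band p n"
        using push_word by meson
      have "ev g = ev (v @ w') + band p n"
        using g(2) w'(3) v(5) by (simp add: add.assoc)
      moreover have "w' \<in> lists (chords {1..n})"
        by (rule chord_words_mono[OF _ w'(1)]) auto
      ultimately have "right_letter n g (p, n)"
        unfolding right_letter_def using g(3) w'(2) v
        by (intro bexI[of _ "v @ w'"]) (auto simp: chords_def)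
      then show False
        using ends_atD[OF g(1)] True x by fastforce
    next
      case False
      then have "f = n" "p = n - 1"
        using neg f foldr_lower_le[of n x f] v(3) by auto
      moreover have "x = []"
      proof (rule ccontr)
        assume "x \<noteq> []"
        then obtain l where "l \<in> set x" by (cases x) auto
        then show False
          using px[of l] x(1) \<open>p = n - 1\<close> by (auto simp: chords_def)
      qed
      ultimately show False
        using neg by simp
    qed
  qed
qed


text \<open>The lower bound is carried through one round in two stages: the last letter of \<open>x\<close> together with the
  inverse of \<open>\<delta>\<close> (\<open>above_last\<close>), then the remaining letters (\<open>above_walk\<close>, \<open>ladder\<close>).\<close>

lemma tail_bound_step:
  assumes n: "3 \<le> n" "n \<le> N" and inv: "tail_invariant n x1 M i h Z"
    and g: "ends_at n (n - 1) (map (unrot n) h)"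
      "ev (map (unrot n) h) = ev h2 + ev x" "length h = length h2 + length x"
    and x: "x \<in> lists (chords {1..n - 1})" and h2: "h2 \<in> lists (chords {1..n})"
    and p: "right_letter n h2 (p, n)"
  shows "2 \<le> p \<and> (above n p (3 * (2 * n - 3) * (M + length x) + (i + 1) * ((2 * n - 3) + (n - 2)))
        (ev x - delta 1 n + Z) \<or>
        p = n - 1 \<and> ev x - delta 1 n + Z = - band (n - 1) n + over_delta (n - 1) (i + 1) (ev x1))"
proof -
  let ?c = "2 * n - 3" and ?g = "map (unrot n) h"
  have h: "h \<in> lists (chords {1..n})" and x1: "x1 \<in> lists (chords {1..n - 1})" "length x1 \<le> M"
    and Z0: "i = 0 \<Longrightarrow> Z = ev x1"
    and good: "\<And>p. right_letter n h (p, n) \<Longrightarrow> (i = 0 \<or> 2 \<le> p) \<and>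
        (above n p (3 * ?c * M + i * (?c + (n - 2))) Z \<or>
         p = n - 1 \<and> Z = - band (n - 1) n + over_delta (n - 1) i (ev x1))"
    using inv by (auto simp: tail_invariant_def)
  have d: "- delta 1 n = - band (n - 1) n + - delta 1 (n - 1)"
    using n by (simp only: delta_last minus_add)
  show ?thesis
  proof (cases x rule: rev_cases)
    \<comment> \<open>an empty factor forces \<open>p = n - 1\<close>, hence \<open>h\<close> ends with \<open>band 1 n\<close>; this excludes all rounds but the first\<close>
    case Nil
    then have "right_letter n ?g (p, n)"
      using p g by (simp add: right_letter_def)
    then have "p = n - 1" "right_letter n h (rot n (p, n))"
      using ends_atD[OF g(1)] n right_letter_rot[OF h n(2)] by fastforce+
    moreover have "rot n (n - 1, n) = (1, n)"
      using n by simp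
    ultimately have "i = 0" "p = n - 1"
      using good[of 1] by auto
    moreover have "ev x - delta 1 n + Z = - band (n - 1) n + over_delta (n - 1) (i + 1) (ev x1)"
      using Nil Z0 \<open>i = 0\<close> d by (simp add: add.assoc[symmetric])
    ultimately show ?thesis
      using n by simp
  next
    case (snoc x' l)
    have "right_letter n ?g l"
      unfolding right_letter_def using snoc g(2,3) h2 x chord_words_mono[of "{1..n - 1}" "{1..n}" x]
      by (intro bexI[of _ "h2 @ x'"]) (auto simp: add.assoc)
    then have "fst l = n - 1 \<or> snd l = n - 1" "right_letter n h (rot n l)"
      using g(1) right_letter_rot[OF h n(2)] by (auto simp: ends_at_def)
    moreover have "l \<in> chords {1..n - 1}"
      using x snoc by auto
    ultimately obtain e where l: "l = (e, n - 1)" "1 \<le> e" "e + 1 < n" and r: "right_letter n h (e + 1, n)"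
      using n by (cases l) (auto simp: chords_def)
    have x': "x' \<in> lists (chords {1..n - 1})"
      using x snoc by auto
    define Z1 where "Z1 = band e (n - 1) - delta 1 n + Z"
    have Z2: "ev x - delta 1 n + Z = ev x' + Z1"
      by (simp add: Z1_def snoc l add.assoc diff_conv_add_uminus del: add_uminus_conv_diff)
    \<comment> \<open>the bound after the last letter of \<open>x\<close>; the exceptional tails reproduce themselves with \<open>f = n\<close>\<close>
    have "\<exists>f. (f = e + 1 \<or> f = n \<and> e = n - 2 \<and> Z1 = - band (n - 1) n + over_delta (n - 1) (i + 1) (ev x1)) \<and>
       above n f (3 * ?c * (M + 1) + (i + 1) * (?c + (n - 2))) Z1"
      using good[OF r, THEN conjunct2]
    proof (elim disjE conjE)
      assume "above n (e + 1) (3 * ?c * M + i * (?c + (n - 2))) Z"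
      from above_last[OF l(2,3) n(2) this]
      have "above n (e + 1) (3 * ?c * (M + 1) + (i + 1) * (?c + (n - 2))) Z1"
        unfolding Z1_def by (rule above_mono) (use l in \<open>simp_all add: add_mult_distrib2\<close>)
      then show ?thesis by blast
    next
      assume e: "e + 1 = n - 1" and Z: "Z = - band (n - 1) n + over_delta (n - 1) i (ev x1)"
      have "unrot n (n - 1, n) = (e, n - 1)" "(n - 1, n) \<in> chords {1..n}"
        using n e by (auto simp: chords_def)
      then have swap: "- delta 1 n + - band (n - 1) n = - band e (n - 1) + - delta 1 n"
        using push_minus[OF minus_delta_unrot[of "(n - 1, n)" n]] n(2) by simp
      have "Z1 = band e (n - 1) + ((- delta 1 n + - band (n - 1) n) + over_delta (n - 1) i (ev x1))"
        by (simp only: Z1_def Z diff_conv_add_uminus add.assoc)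
      then have "Z1 = - delta 1 n + over_delta (n - 1) i (ev x1)"
        unfolding swap by (simp only: add.assoc add_minus_cancel)
      then have Z1: "Z1 = - band (n - 1) n + over_delta (n - 1) (i + 1) (ev x1)"
        unfolding d by (simp add: add.assoc del: add_uminus_conv_diff)
      have "sigma_nonneg n (?c * length x1 + (i + 1) * (n - 2)) (over_delta (n - 1) (i + 1) (ev x1))"
        using x1(1) chord_words_mono[of "{1..n - 1}" "{1..n}" x1] n
        by (intro sigma_nonneg_over_delta) auto
      moreover have "?c + (?c * length x1 + (i + 1) * (n - 2))
         \<le> 3 * ?c * (M + 1) + (i + 1) * (?c + (n - 2))"
      proof -
        have bound: "c + (c * a + j * b) \<le> 3 * c * (a + d + 1) + j * (c + b)" for a b c d j :: nat
          by (simp add: algebra_simps)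
        obtain d where M: "M = length x1 + d"
          using x1(2) le_iff_add by blast
        show ?thesis
          unfolding M by (rule bound)
      qed
      ultimately have "above n n (3 * ?c * (M + 1) + (i + 1) * (?c + (n - 2))) Z1"
        using Z1 by (rule above_topI)
      moreover have "e = n - 2" using e by simp
      ultimately show ?thesis
        using Z1 by blast
    qed
    then obtain f where f: "f = e + 1 \<or> f = n \<and> e = n - 2 \<and> Z1 = - band (n - 1) n + over_delta (n - 1) (i + 1) (ev x1)"
      and Z1: "above n f (3 * ?c * (M + 1) + (i + 1) * (?c + (n - 2))) Z1"
      by blast
    have "foldr (lower n) x' f \<le> p \<or> x' = [] \<and> f = n \<and> p = n - 1"
      by (rule ladder[OF n h2 x' l(3,2) g(1) _ _ _ p]) (use g(2,3) snoc l f in auto)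
    then show ?thesis
    proof (elim disjE conjE)
      assume a: "foldr (lower n) x' f \<le> p"
      have "above n (foldr (lower n) x' f)
         (3 * ?c * (M + 1) + (i + 1) * (?c + (n - 2)) + 3 * ?c * length x') (ev x' + Z1)"
        using f l n by (intro above_walk[OF x' _ n(2) Z1]) auto
      moreover have "p < n"
        using p by (auto simp: right_letter_def chords_def)
      moreover have "A * (M + 1) + B + A * length x' \<le> A * (M + length x) + B" for A B
        by (simp add: snoc add_mult_distrib2)
      ultimately have "above n p (3 * ?c * (M + length x) + (i + 1) * (?c + (n - 2))) (ev x' + Z1)"
        using above_mono a by blast
      moreover have "2 \<le> p"
        using foldr_lower_ge2[OF x', of f n] a f l n by auto
      ultimately show ?thesis
        unfolding Z2 by blast
    next
      assume "x' = []" "f = n" "p = n - 1"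
      then show ?thesis
        unfolding Z2 using f l n by auto
    qed
  qed
qed

lemma tail_invariant_step:
  assumes n: "3 \<le> n" "n \<le> N" and inv: "tail_invariant n x1 M i h Z"
  obtains h2 M2 Z2 where "tail_invariant n x1 M2 (i + 1) h2 Z2" "length h2 + M2 = length h + M"
    "- delta 1 n + ev h + Z = ev h2 + Z2"
proof -
  let ?c = "2 * n - 3" and ?g = "map (unrot n) h"
  have h: "h \<in> lists (chords {1..n})" and x1: "x1 \<in> lists (chords {1..n - 1})" "length x1 \<le> M"
    and np: "sigma_nonpos n (?c * M + i * (n - 1)) Z" and nn: "ends_at n n h"
    using inv by (auto simp: tail_invariant_def)
  have "?g \<in> lists (chords {1..n})"
    using h unrot_chord by (induction h) auto
  then obtain h2 x where hx: "h2 \<in> lists (chords {1..n})" "x \<in> lists (chords {1..n - 1})"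
    "ends_at n n h2" "ev ?g = ev h2 + ev x" "length ?g = length h2 + length x"
    using split_tail by blast
  have g: "ends_at n (n - 1) ?g"
    using ends_at_unrot[OF h n(2) _ nn] n by simp
  have "sigma_neg n (?c * length x + ((n - 1) + (?c * M + i * (n - 1)))) (ev x + (- delta 1 n + Z))"
    using sigma_nonpos_ev[OF hx(2)] minus_delta_words(2)[of n] np n
    by (intro sigma_nonpos_add_neg sigma_neg_add_nonpos) auto
  moreover have "ev x + (- delta 1 n + Z) = ev x - delta 1 n + Z"
    by (simp only: add.assoc diff_conv_add_uminus)
  moreover have "?c * length x + ((n - 1) + (?c * M + i * (n - 1))) = ?c * (M + length x) + (i + 1) * (n - 1)"
    by (simp add: add_mult_distrib2)
  ultimately have neg: "sigma_neg n (?c * (M + length x) + (i + 1) * (n - 1)) (ev x - delta 1 n + Z)"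
    by metis
  have "tail_invariant n x1 (M + length x) (i + 1) h2 (ev x - delta 1 n + Z)"
    unfolding tail_invariant_def
    using hx x1 neg sigma_neg_nonpos[OF neg] tail_bound_step[OF n inv g hx(4) _ hx(2,1)] by auto
  moreover have "- delta 1 n + ev h + Z = ev h2 + (ev x - delta 1 n + Z)"
  proof -
    have "ev h + delta 1 n = delta 1 n + (ev h2 + ev x)"
      using delta_unrot_word[OF h n(2)] hx(4) by simp
    then have "- delta 1 n + ev h + delta 1 n = ev h2 + ev x"
      by (simp add: add.assoc)
    then have "- delta 1 n + ev h = ev h2 + ev x - delta 1 n"
      by (simp add: eq_diff_eq)
    then show ?thesis
      by (simp add: add.assoc diff_conv_add_uminus del: add_uminus_conv_diff)
  qed
  ultimately show ?thesis
    using that hx(5) by simp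
qed

end

section \<open>Short sigma-definite words\<close>

lemma braid_words_mono: "u \<in> braid_words m \<Longrightarrow> m \<le> n \<Longrightarrow> u \<in> braid_words n"
  by (fastforce simp: braid_words_def)

lemma max_index_eq:
  assumes "u \<in> braid_words n" "l \<in> set u" "index l = n - 1"
  shows "max_index u = n - 1"
  unfolding max_index_def
proof (rule Max_eqI)
  show "n - 1 \<in> index ` set u"
    using assms(2,3) by (metis imageI)
qed (use assms(1) in \<open>auto simp: braid_words_def\<close>)

context artin_generators
begin

lemma sigma_definite_if_pos:
  assumes "sigma_pos n m x"
  shows "\<exists>u\<in>braid_words n. sigma_definite u \<and> val u = x \<and> length u \<le> m"
proof -
  obtain u where u: "u \<in> braid_words n" "val u = x" "length u \<le> m"
    "SigInv (n - 1) \<notin> set u" "Sig (n - 1) \<in> set u"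
    using assms by (auto simp: sigma_pos_def)
  then have "max_index u = n - 1"
    using max_index_eq[of u n "Sig (n - 1)"] by simp
  then have "sigma_definite u"
    using u by (auto simp: sigma_definite_def sigma_positive_def)
  then show ?thesis using u by blast
qed

lemma sigma_definite_if_neg:
  assumes "sigma_neg n m x"
  shows "\<exists>u\<in>braid_words n. sigma_definite u \<and> val u = x \<and> length u \<le> m"
proof -
  obtain u where u: "u \<in> braid_words n" "val u = x" "length u \<le> m"
    "Sig (n - 1) \<notin> set u" "SigInv (n - 1) \<in> set u"
    using assms by (auto simp: sigma_neg_def)
  then have "max_index u = n - 1"
    using max_index_eq[of u n "SigInv (n - 1)"] by simp
  then have "sigma_definite u"
    using u by (auto simp: sigma_definite_def sigma_negative_def)
  then show ?thesis using u by blast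
qed

lemma tail_invariant_start:
  assumes x: "x \<in> lists (chords {1..n - 1})" and h: "h \<in> lists (chords {1..n})" "ends_at n n h"
  shows "tail_invariant n x (length x) 0 h (ev x)"
proof -
  have "above n p (3 * (2 * n - 3) * length x) (ev x)" if "p < n" for p
    using x chord_words_mono[of "{1..n - 1}" "{1..n}" x] that
    by (intro aboveI[OF signed_word.empty sigma_nonneg_ev]) auto
  moreover have "p < n" if "right_letter n h (p, n)" for p
    using that by (auto simp: right_letter_def chords_def)
  ultimately show ?thesis
    unfolding tail_invariant_def using assms sigma_nonpos_ev[OF x] by auto
qed

lemma tail_invariant_reachable:
  assumes n: "3 \<le> n" "n \<le> N" and w: "w \<in> lists (chords {1..n})"
  obtains h x1 M Z where "tail_invariant n x1 M i h Z" "length h + M = length w"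
    "over_delta n i (ev w) = ev h + Z"
proof -
  have "\<exists>h x1 M Z. tail_invariant n x1 M i h Z \<and> length h + M = length w \<and>
    over_delta n i (ev w) = ev h + Z"
  proof (induction i)
    case 0
    obtain h x where "h \<in> lists (chords {1..n})" "x \<in> lists (chords {1..n - 1})" "ends_at n n h"
      "ev w = ev h + ev x" "length w = length h + length x"
      using split_tail[OF w] .
    then show ?case
      using tail_invariant_start over_delta_simps(1) by metis
  next
    case (Suc i)
    then obtain h x1 M Z where inv: "tail_invariant n x1 M i h Z" "length h + M = length w"
      "over_delta n i (ev w) = ev h + Z"
      by blast
    from tail_invariant_step[OF n inv(1)] obtain h2 M2 Z2
      where "tail_invariant n x1 M2 (i + 1) h2 Z2" "length h2 + M2 = length h + M"
        "- delta 1 n + ev h + Z = ev h2 + Z2"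
      by blast
    then show ?case
      using inv(2,3) by (metis Suc_eq_plus1 add.assoc over_delta_simps(2))
  qed
  then show ?thesis
    using that by blast
qed

text \<open>Conjugation by \<open>\<delta>\<close> permutes the bands, so positive words can be moved through denominators.\<close>

lemma move_into_over_delta:
  assumes w: "w \<in> lists (chords {1..n})" and n: "n \<le> N"
  shows "\<exists>w'\<in>lists (chords {1..n}). length w' = length w \<and>
    ev w + over_delta n k y = over_delta n k (ev w' + y)"
  using w
proof (induction k arbitrary: w)
  case 0
  then show ?case by auto
next
  case (Suc k)
  let ?w = "map (rot n) w"
  have "?w \<in> lists (chords {1..n})"
    using Suc.prems rot_chord by (induction w) auto
  then obtain w' where w': "w' \<in> lists (chords {1..n})" "length w' = length w"
    "ev ?w + over_delta n k y = over_delta n k (ev w' + y)"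
    using Suc.IH by (metis length_map)
  have "ev w + - delta 1 n = - delta 1 n + (delta 1 n + ev w) + - delta 1 n"
    by (simp only: minus_add_cancel)
  also have "\<dots> = - delta 1 n + ev ?w"
    by (simp only: delta_rot_word[OF Suc.prems n] add.assoc right_minus add.right_neutral)
  finally have "ev w + over_delta n (Suc k) y = over_delta n (Suc k) (ev w' + y)"
    using w'(3) by (simp add: add.assoc[symmetric]) (simp add: add.assoc)
  then show ?case
    using w' by blast
qed

lemma over_delta_two_strands:
  assumes "w \<in> lists (chords {1..2})"
  shows "\<exists>a. a \<le> k + length w \<and>
    (over_delta 2 k (ev w) = val (replicate a (Sig 1)) \<or> over_delta 2 k (ev w) = val (replicate a (SigInv 1)))"
proof (induction k)
  case 0
  have b: "band' l = s 1" if "l \<in> chords {1..2}" for l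
  proof -
    have "l = (1, 2)"
      using that by (auto simp: chords_def)
    then show ?thesis
      by (simp add: band_def delta_def numeral_2_eq_2)
  qed
  have "ev w = val (replicate (length w) (Sig 1))"
    using assms
  proof (induction w)
    case (Cons l w)
    then show ?case using b[of l] by simp
  qed simp
  then show ?case by auto
next
  case (Suc k)
  have d: "delta 1 2 = s 1"
    by (simp add: delta_def numeral_2_eq_2)
  from Suc obtain a where a: "a \<le> k + length w"
    "over_delta 2 k (ev w) = val (replicate a (Sig 1)) \<or> over_delta 2 k (ev w) = val (replicate a (SigInv 1))"
    by blast
  from a(2) show ?case
  proof
    assume e: "over_delta 2 k (ev w) = val (replicate a (SigInv 1))"
    then show ?thesis
      using a(1) d by (intro exI[of _ "Suc a"]) simp
  next
    assume e: "over_delta 2 k (ev w) = val (replicate a (Sig 1))"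
    show ?thesis
    proof (cases a)
      case 0
      then show ?thesis
        using e d by (intro exI[of _ 1]) simp
    next
      case (Suc b)
      then show ?thesis
        using a(1) e d by (intro exI[of _ b]) simp
    qed
  qed
qed

text \<open>Induction on the number of strands: the exceptional tails lead to a fraction on one strand less with the
  same \<open>k\<close> and at most as many bands, so that the bound does not accumulate.\<close>

proposition over_delta_sigma_definite:
  assumes "2 \<le> n" "n \<le> N" "w \<in> lists (chords {1..n})" "length w \<le> L"
  shows "\<exists>u\<in>braid_words n. sigma_definite u \<and> val u = over_delta n k (ev w) \<and>
    length u \<le> (2 * n - 3) * (3 * L + k) + k * (n - 2)"
  using assms
proof (induction n arbitrary: w rule: nat_induct_at_least)
  case base
  obtain a where a: "a \<le> k + length w"
    "over_delta 2 k (ev w) = val (replicate a (Sig 1)) \<or> over_delta 2 k (ev w) = val (replicate a (SigInv 1))"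
    using over_delta_two_strands base by blast
  have "sigma_definite (replicate a (Sig i))" "sigma_definite (replicate a (SigInv i))" for i
    by (auto simp: sigma_definite_def sigma_positive_def sigma_negative_def)
  moreover have "replicate a (Sig 1) \<in> braid_words 2" "replicate a (SigInv 1) \<in> braid_words 2"
    by (auto simp: braid_words_def)
  moreover have "a \<le> (2 * 2 - 3) * (3 * L + k) + k * (2 - 2)"
    using a(1) base by simp
  ultimately show ?case
    using a(2) by (metis length_replicate)
next
  case (Suc m)
  define n where "n = Suc m"
  let ?c = "2 * n - 3" and ?B = "(2 * n - 3) * (3 * L + k) + k * (n - 2)"
  have n: "3 \<le> n" "n \<le> N" "n - 1 = m"
    using Suc by (auto simp: n_def)
  have w: "w \<in> lists (chords {1..n})" "length w \<le> L"
    using Suc.prems by (auto simp: n_def)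
  have fewer: "\<exists>u\<in>braid_words n. sigma_definite u \<and> val u = over_delta (n - 1) k (ev v) \<and> length u \<le> ?B"
    if v: "v \<in> lists (chords {1..n - 1})" "length v \<le> L" for v
  proof -
    have "m \<le> N" "v \<in> lists (chords {1..m})"
      using n(2,3) v(1) by simp_all
    from Suc.IH[OF this v(2)] obtain u where u: "u \<in> braid_words m" "sigma_definite u"
      "val u = over_delta m k (ev v)" "length u \<le> (2 * m - 3) * (3 * L + k) + k * (m - 2)"
      by blast
    have "length u \<le> ?B"
      using u(4) by (rule order_trans) (use n in \<open>auto intro!: add_mono mult_le_mono\<close>)
    then show ?thesis
      using u braid_words_mono[of u m n] n by auto
  qed
  let ?goal = "\<exists>u\<in>braid_words n. sigma_definite u \<and> val u = over_delta n k (ev w) \<and> length u \<le> ?B"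
  have pos: ?goal if "sigma_pos n b (over_delta n k (ev w))" "b \<le> ?B" for b
    using sigma_definite_if_pos[OF sigma_pos_mono[OF that]] .
  have c: "?c * length w \<le> ?c * L"
    using w(2) by simp
  have ?goal
  proof (cases "k = 0")
    case True
    show ?thesis
    proof (cases "w \<in> lists (chords {1..n - 1})")
      case True
      from fewer[OF this w(2)] show ?thesis
        using \<open>k = 0\<close> by simp
    next
      case False
      show ?thesis
        by (rule pos[where b = "?c * length w"])
           (use sigma_pos_ev[OF w(1) False] \<open>k = 0\<close> w(2) in simp_all)
    qed
  next
    case False
    obtain h x1 M Z where inv: "tail_invariant n x1 M k h Z" and len: "length h + M = length w"
      and X: "over_delta n k (ev w) = ev h + Z"
      using tail_invariant_reachable[OF n(1,2) w(1)] .
    have h: "h \<in> lists (chords {1..n})" "ends_at n n h"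
      and x1: "x1 \<in> lists (chords {1..n - 1})" "length x1 \<le> M"
      and Z: "sigma_neg n (?c * M + k * (n - 1)) Z"
      and good: "\<And>p. right_letter n h (p, n) \<Longrightarrow>
        above n p (3 * ?c * M + k * (?c + (n - 2))) Z \<or>
         p = n - 1 \<and> Z = - band (n - 1) n + over_delta (n - 1) k (ev x1)"
      using inv False by (auto simp: tail_invariant_def)
    show ?thesis
    proof (cases h rule: rev_cases)
      case Nil
      have e: "n - 1 = Suc (n - 2)"
        using n by simp
      have "1 \<le> ?c"
        using n(1) by linarith
      then have "k \<le> ?c * k"
        using mult_le_mono1[of 1 ?c k] by simp
      moreover have "?c * M \<le> ?c * (3 * L)"
        using len Nil w(2) by (intro mult_le_mono2) simp
      ultimately have "?c * M + k * (n - 1) \<le> ?B"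
        unfolding e add_mult_distrib2 mult_Suc_right by linarith
      then show ?thesis
        using sigma_definite_if_neg[OF sigma_neg_mono[OF Z]] X Nil by simp
    next
      \<comment> \<open>the last letter of \<open>h\<close> ends at \<open>n\<close> and decides the sign\<close>
      case (snoc h' l)
      have rl: "right_letter n h l"
        unfolding right_letter_def using h(1) snoc by (intro bexI[of _ h']) auto
      moreover have "l \<in> chords {1..n}"
        using h(1) snoc by auto
      ultimately obtain p where l: "l = (p, n)" "1 \<le> p" "p < n"
        using h(2) ends_atD[OF h(2)] by (cases l) (fastforce simp: chords_def)
      have h': "h' \<in> lists (chords {1..n})"
        using h(1) snoc by auto
      have c': "?c * length h' + ?c + ?c * M \<le> ?c * L"
      proof -
        have "?c * (length h' + 1 + M) \<le> ?c * L"
          using len w(2) snoc by (intro mult_le_mono2) simp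
        then show ?thesis by (simp add: add_mult_distrib2)
      qed
      from good[OF rl[unfolded l(1)]] show ?thesis
      proof (elim disjE conjE)
        assume "above n p (3 * ?c * M + k * (?c + (n - 2))) Z"
        from above_sigma_pos[OF l(2,3) n(2) this]
        have "sigma_pos n (?c * length h' + (3 * ?c * M + k * (?c + (n - 2)) + ?c)) (ev h' + (band p n + Z))"
          by (rule sigma_nonneg_add_pos[OF sigma_nonneg_ev[OF h']])
        then show ?thesis
          by (intro pos[where b = "?c * length h' + (3 * ?c * M + k * (?c + (n - 2)) + ?c)"])
             (use c' in \<open>simp_all add: X snoc l add.assoc add_mult_distrib2 mult.commute[of k]\<close>)
      next
        \<comment> \<open>the last letter of \<open>h\<close> cancels against the tail\<close>
        assume "p = n - 1" "Z = - band (n - 1) n + over_delta (n - 1) k (ev x1)"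
        then have X': "over_delta n k (ev w) = ev h' + over_delta (n - 1) k (ev x1)"
          using X by (simp add: snoc l add.assoc)
        show ?thesis
        proof (cases "h' \<in> lists (chords {1..n - 1})")
          case True
          have "n - 1 \<le> N"
            using n(2) by simp
          from move_into_over_delta[OF True this, of k "ev x1"]
          obtain v where v: "v \<in> lists (chords {1..n - 1})" "length v = length h'"
            "ev h' + over_delta (n - 1) k (ev x1) = over_delta (n - 1) k (ev v + ev x1)"
            by blast
          have "length (v @ x1) \<le> L"
            using v(2) x1(2) len w(2) snoc by simp
          then show ?thesis
            using fewer[of "v @ x1"] v x1(1) X' by simp
        next
          case False
          have "sigma_pos n (?c * length h' + (?c * length x1 + k * (n - 2)))
              (ev h' + over_delta (n - 1) k (ev x1))"
            using sigma_pos_ev[OF h' False] x1(1) chord_words_mono[of "{1..n - 1}" "{1..n}" x1] n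
            by (intro sigma_pos_add_nonneg sigma_nonneg_over_delta) auto
          moreover have "?c * (length h' + length x1) \<le> ?c * (3 * L + k)"
            using x1(2) len w(2) snoc by (intro mult_le_mono2) simp
          then have "?c * length h' + (?c * length x1 + k * (n - 2)) \<le> ?B"
            unfolding add_mult_distrib2 by linarith
          ultimately show ?thesis
            using pos X' by simp
        qed
      qed
    qed
  qed
  then show ?case
    by (simp only: n_def)
qed

lemma delta_as_word: "delta p q = ev (map (\<lambda>j. (j, j + 1)) [p..<q])"
  by (simp add: delta_def ev_def o_def band_def)

text \<open>Pushing \<open>s i\<close> to the right end of \<open>delta 1 n\<close> shows that it is a right divisor of it, with \<open>n - 2\<close>
  bands left over.\<close>

lemma minus_generator:
  assumes "1 \<le> i" "i < n" "n \<le> N"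
  shows "\<exists>y\<in>lists (chords {1..n}). length y = n - 2 \<and> - s i = - delta 1 n + ev y"
proof -
  let ?simple = "map (\<lambda>j. (j, j + 1))"
  have b: "s i = band i (i + 1)"
    by (simp add: band_def delta_def)
  have "?simple [i + 1..<n] \<in> lists (chords {i + 1..n})"
    by (auto simp: chords_def)
  moreover have "\<exists>l'\<in>chords {1..n}. band i (i + 1) + band' l = band' l' + band i (i + 1)"
    if "l \<in> chords {i + 1..n}" for l
    by (rule push_band_outside[OF _ _ _ _ _ _ that]) (use assms in auto)
  ultimately obtain y where y: "y \<in> lists (chords {1..n})" "length y = length (?simple [i + 1..<n])"
    "s i + delta (i + 1) n = ev y + s i"
    unfolding b delta_as_word using push_word by meson
  have "delta 1 n = delta 1 i + (s i + delta (i + 1) n)"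
    using assms delta_split[of 1 i n] delta_first[of i n] by simp
  then have "delta 1 n = ev (?simple [1..<i] @ y) + s i"
    unfolding y(3) delta_as_word[of 1 i] by (simp add: add.assoc)
  then have "- s i = - delta 1 n + ev (?simple [1..<i] @ y)"
    by (simp add: minus_add add.assoc del: ev_simps(3))
  moreover have "?simple [1..<i] @ y \<in> lists (chords {1..n})"
    using y(1) assms by (auto simp: chords_def)
  moreover have "length (?simple [1..<i] @ y) = n - 2"
    using y(2) assms by simp
  ultimately show ?thesis by blast
qed

lemma word_as_over_delta:
  assumes "2 \<le> n" "n \<le> N" "u \<in> braid_words n"
  shows "\<exists>k w. w \<in> lists (chords {1..n}) \<and> k \<le> length u \<and> length w + k = length u + (n - 2) * k \<and>
    val u = over_delta n k (ev w)"
  using assms(3)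
proof (induction u)
  case Nil
  show ?case by (intro exI[of _ 0] exI[of _ "[]"]) auto
next
  case (Cons l u)
  then obtain k w where w: "w \<in> lists (chords {1..n})" "k \<le> length u"
    "length w + k = length u + (n - 2) * k" "val u = over_delta n k (ev w)"
    by (auto simp: braid_words_Cons[of l u])
  have l: "1 \<le> index l" "index l < n"
    using Cons.prems by (auto simp: braid_words_def)
  show ?case
  proof (cases l)
    case (Sig i)
    then have "[(i, i + 1)] \<in> lists (chords {1..n})"
      using l by (auto simp: chords_def)
    from move_into_over_delta[OF this assms(2), of k "ev w"]
    obtain v where v: "v \<in> lists (chords {1..n})" "length v = 1"
      "band i (i + 1) + over_delta n k (ev w) = over_delta n k (ev v + ev w)"
      by auto
    have "s i = band i (i + 1)"
      by (simp add: band_def delta_def)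
    then have "val (l # u) = over_delta n k (ev (v @ w))"
      using v(3) w(4) Sig by simp
    then show ?thesis
      using v(1,2) w by (intro exI[of _ k] exI[of _ "v @ w"]) auto
  next
    case (SigInv i)
    obtain y where y: "y \<in> lists (chords {1..n})" "length y = n - 2" "- s i = - delta 1 n + ev y"
      using minus_generator[of i n] l SigInv assms(2) by auto
    from move_into_over_delta[OF y(1) assms(2), of k "ev w"]
    obtain v where v: "v \<in> lists (chords {1..n})" "length v = n - 2"
      "ev y + over_delta n k (ev w) = over_delta n k (ev v + ev w)"
      using y(2) by auto
    have "val (l # u) = over_delta n (Suc k) (ev (v @ w))"
      using v(3) w(4) y(3) SigInv by (simp add: add.assoc)
    then show ?thesis
      using v(1,2) w by (intro exI[of _ "Suc k"] exI[of _ "v @ w"]) auto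
  qed
qed

lemma length_bound_arith:
  fixes n k l L :: nat
  assumes "2 \<le> n" "k \<le> l" "L + k = l + (n - 2) * k"
  shows "(2 * n - 3) * (3 * L + k) + k * (n - 2) \<le> 6 * (n - 1)\<^sup>2 * l"
proof -
  obtain m where m: "n = m + 2"
    using assms(1) le_iff_add by (metis add.commute)
  obtain j where j: "l = k + j"
    using assms(2) le_iff_add by blast
  have L: "L = j + m * k" "2 * n - 3 = 2 * m + 1" "n - 2 = m" "n - 1 = m + 1"
    using assms(3) by (simp_all add: m j)
  have "6 * (m + 1)\<^sup>2 * (k + j) =
      (2 * m + 1) * (3 * (j + m * k) + k) + k * m + (k * (6 * m + 5) + j * (6 * m * m + 6 * m + 3))"
    by (simp add: power2_eq_square algebra_simps)
  then show ?thesis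
    unfolding L j by simp
qed

proposition short_sigma_definite_word:
  assumes "2 \<le> n" "n \<le> N" "u \<in> braid_words n"
  shows "\<exists>v\<in>braid_words n. sigma_definite v \<and> val v = val u \<and> length v \<le> 6 * (n - 1)\<^sup>2 * length u"
proof -
  obtain k w where w: "w \<in> lists (chords {1..n})" "k \<le> length u"
    "length w + k = length u + (n - 2) * k" "val u = over_delta n k (ev w)"
    using word_as_over_delta[OF assms] by blast
  obtain v where "v \<in> braid_words n" "sigma_definite v" "val v = over_delta n k (ev w)"
    "length v \<le> (2 * n - 3) * (3 * length w + k) + k * (n - 2)"
    using over_delta_sigma_definite[OF assms(1,2) w(1) order_refl] by blast
  then show ?thesis
    using length_bound_arith[OF assms(1) w(2,3)] w(4) by (intro bexI[of _ v]) auto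
qed

end

section \<open>The braid groups as a single type\<close>

text \<open>A type cannot depend on \<open>n\<close>, so the groups of all strand numbers are put into their product, which is a
  group on a single type. Its \<open>n\<close>-th component carries the equations of the \<open>n\<close>-strand group.\<close>

typedef braid_family = "{f. \<forall>n. f n \<in> carrier (braid_group n)}" morphisms component Family
proof
  show "(\<lambda>n. \<one>\<^bsub>braid_group n\<^esub>) \<in> {f. \<forall>n. f n \<in> carrier (braid_group n)}"
    by (simp add: group.is_monoid group_braid_group monoid.one_closed)
qed

lemma component_in_carrier [simp]: "component x n \<in> carrier (braid_group n)"
  using component[of x] by simp

lemma component_Family: "(\<And>n. f n \<in> carrier (braid_group n)) \<Longrightarrow> component (Family f) n = f n"
  by (simp add: Family_inverse)

lemma braid_family_eqI: "(\<And>n. component x n = component y n) \<Longrightarrow> x = y"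
  by (simp add: component_inject[symmetric] fun_eq_iff)

instantiation braid_family :: group_add
begin

definition "0 = Family (\<lambda>n. \<one>\<^bsub>braid_group n\<^esub>)"
definition "x + y = Family (\<lambda>n. component x n \<otimes>\<^bsub>braid_group n\<^esub> component y n)"
definition "- x = Family (\<lambda>n. inv\<^bsub>braid_group n\<^esub> component x n)"
definition "x - (y :: braid_family) = x + - y"

lemma component_ops:
  "component 0 n = \<one>\<^bsub>braid_group n\<^esub>"
  "component (x + y) n = component x n \<otimes>\<^bsub>braid_group n\<^esub> component y n"
  "component (- x) n = inv\<^bsub>braid_group n\<^esub> component x n"
proof -
  interpret group "braid_group k" for k by (rule group_braid_group)
  show "component 0 n = \<one>\<^bsub>braid_group n\<^esub>"
    "component (x + y) n = component x n \<otimes>\<^bsub>braid_group n\<^esub> component y n"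
    "component (- x) n = inv\<^bsub>braid_group n\<^esub> component x n"
    by (simp_all add: zero_braid_family_def plus_braid_family_def uminus_braid_family_def component_Family)
qed

instance
proof
  fix x y z :: braid_family
  interpret group "braid_group k" for k by (rule group_braid_group)
  show "x + y + z = x + (y + z)" "0 + x = x" "x + 0 = x" "- x + x = 0"
    by (auto intro!: braid_family_eqI simp: component_ops m_assoc)
qed (simp add: minus_braid_family_def)

end

definition generator :: "nat \<Rightarrow> nat \<Rightarrow> braid_family" where
  "generator n i = Family (\<lambda>m. if m = n \<and> 1 \<le> i \<and> i < n then braid_of n [Sig i] else \<one>\<^bsub>braid_group m\<^esub>)"

lemma component_generator:
  "component (generator n i) m =
    (if m = n \<and> 1 \<le> i \<and> i < n then braid_of n [Sig i] else \<one>\<^bsub>braid_group m\<^esub>)"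
proof -
  interpret group "braid_group k" for k by (rule group_braid_group)
  show ?thesis
    unfolding generator_def
    by (subst component_Family) (auto simp: braid_group_def braid_words_def)
qed

lemma artin_generators_generator: "artin_generators (generator n) n"
proof
  fix i j assume ij: "1 \<le> i" "i + 2 \<le> j" "j < n"
  interpret group "braid_group k" for k by (rule group_braid_group)
  have w: "[Sig i] \<in> braid_words n" "[Sig j] \<in> braid_words n"
    using ij by (auto simp: braid_words_def)
  have "braid_rule n [Sig i, Sig j] [Sig j, Sig i]"
    by (rule braid_rule.far) (use ij in \<open>auto simp: braid_words_def\<close>)
  then have "braid_of n [Sig i, Sig j] = braid_of n [Sig j, Sig i]"
    using braid_equiv.rule[of "[]" n "[]"] w braid_of_eq_iff[of "[Sig i, Sig j]" n]
    by (auto simp: braid_words_def)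
  then show "generator n i + generator n j = generator n j + generator n i"
    using ij w by (auto intro!: braid_family_eqI simp: component_ops component_generator mult_braid_of)
next
  fix i assume i: "1 \<le> i" "i + 1 < n"
  interpret group "braid_group k" for k by (rule group_braid_group)
  let ?j = "i + 1"
  have w: "[Sig i] \<in> braid_words n" "[Sig ?j] \<in> braid_words n"
    "[Sig i, Sig ?j] \<in> braid_words n" "[Sig ?j, Sig i] \<in> braid_words n"
    using i by (auto simp: braid_words_def)
  have "braid_rule n [Sig i, Sig ?j, Sig i] [Sig ?j, Sig i, Sig ?j]"
    by (rule braid_rule.near) (use i in \<open>auto simp: braid_words_def\<close>)
  then have "braid_of n [Sig i, Sig ?j, Sig i] = braid_of n [Sig ?j, Sig i, Sig ?j]"
    using braid_equiv.rule[of "[]" n "[]"] w braid_of_eq_iff[of "[Sig i, Sig ?j, Sig i]" n]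
    by (auto simp: braid_words_def)
  then show "generator n i + generator n ?j + generator n i = generator n ?j + generator n i + generator n ?j"
    using i w by (auto intro!: braid_family_eqI simp: component_ops component_generator mult_braid_of)
qed

interpretation braids: artin_generators "generator n" n for n
  by (rule artin_generators_generator)

lemma component_val:
  assumes "u \<in> braid_words n"
  shows "component (braids.val n u) n = braid_of n u"
  using assms
proof (induction u)
  case Nil
  show ?case by (simp add: component_ops braid_group_def)
next
  case (Cons l u)
  interpret group "braid_group k" for k by (rule group_braid_group)
  have lu: "[l] \<in> braid_words n" "u \<in> braid_words n"
    using Cons.prems braid_words_Cons by blast+
  have "component (braids.val_letter n l) n = braid_of n [l]"
  proof (cases l)
    case (Sig i)
    then show ?thesis
      using lu by (simp add: component_generator braid_words_def)
  next
    case (SigInv i)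
    have i: "[Sig i] \<in> braid_words n" "1 \<le> i" "i < n"
      using lu SigInv by (auto simp: braid_words_def)
    have "[SigInv i, Sig i] \<in> braid_words n"
      using i by (simp add: braid_words_def)
    then have "braid_of n [SigInv i, Sig i] = braid_of n []"
      using braid_equiv_inverse[OF i(1)] by (simp add: braid_of_eq_iff)
    moreover have "\<one>\<^bsub>braid_group n\<^esub> = braid_of n []"
      by (simp add: braid_group_def)
    ultimately have "braid_of n [SigInv i] \<otimes>\<^bsub>braid_group n\<^esub> braid_of n [Sig i] = \<one>\<^bsub>braid_group n\<^esub>"
      using mult_braid_of[of "[SigInv i]" n "[Sig i]"] lu i SigInv by simp
    then have "inv\<^bsub>braid_group n\<^esub> braid_of n [Sig i] = braid_of n [SigInv i]"
      by (rule inv_equality) (use lu i SigInv in \<open>auto simp: braid_group_def\<close>)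
    then show ?thesis
      using i SigInv by (simp add: component_ops component_generator)
  qed
  then show ?case
    using Cons.IH[OF lu(2)] mult_braid_of[OF lu] by (simp add: component_ops)
qed

theorem theorem1:
  fixes n :: nat and \<beta> :: "braid_word set"
  assumes "n \<ge> 2" and "\<beta> \<in> carrier (braid_group n)"
  shows "\<exists>w \<in> braid_words n. sigma_definite w \<and> braid_of n w = \<beta> \<and>
           length w \<le> 6 * (n - 1)^2 * sigma_length n \<beta>"
proof -
  have "\<exists>k. \<exists>w\<in>braid_words n. braid_of n w = \<beta> \<and> length w = k"
    using assms(2) by (auto simp: braid_group_def)
  from LeastI_ex[OF this] obtain u
    where u: "u \<in> braid_words n" "braid_of n u = \<beta>" "length u = sigma_length n \<beta>"
    unfolding sigma_length_def by blast
  obtain w where w: "w \<in> braid_words n" "sigma_definite w" "braids.val n w = braids.val n u"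
    "length w \<le> 6 * (n - 1)\<^sup>2 * length u"
    using braids.short_sigma_definite_word[OF assms(1) order_refl u(1)] by blast
  then have "braid_of n w = \<beta>"
    using component_val u(1,2) by metis
  then show ?thesis
    using w u(3) by auto
qed

end
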